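(* Let $1<p<\infty$ and let $\psi\in\mathfrak{M}''_{\infty}$ be differentiable and such that $\frac{\psi(t)}{|\psi'(t)|}$ increases monotonically to $\infty$ as $t\to\infty$. Then for every $\beta\in\mathbb{R}$, $$e^{\bot}_{2n-1}(L^{\psi}_{\beta,p})_{\infty}\asymp e^{\bot}_{2n}(L^{\psi}_{\beta,p})_{\infty}\asymp \psi(n)\,(\eta(n)-n)^{1/p},\qquad n\in\mathbb{N}.$$
   Context: $L_p$ ($1\le p<\infty$) is the space of $2\pi$-periodic functions with $\|f\|_p=(\int_0^{2\pi}|f|^p)^{1/p}<\infty$; $L_\infty$ is the space of essentially bounded $2\pi$-periodic measurable functions with the ess sup norm. For $f\in L_1$, $\hat f(k)=\frac{1}{2\pi}\int_{-\pi}^{\pi}f(t)e^{-ikt}dt$. Given a sequence $\psi(k)$ and $\beta\in\mathbb{R}$, if $\sum_{k\in\mathbb{Z}\setminus\{0\}}\frac{\hat f(k)}{\psi(|k|)}e^{i(kx+\frac{\beta\pi}{2}\mathrm{sign}\,k)}$ is the Fourier series of some $\varphi\in L_1$, then $\varphi=:f^{\psi}_{\beta}$ is the $(\psi,\beta)$-derivative of $f$. Let $B^0_p=\{\varphi\in L_p:\|\varphi\|_p\le1,\ \int_{-\pi}^{\pi}\varphi=0\}$; the class $L^{\psi}_{\beta,p}$ is the set of $f$ whose $(\psi,\beta)$-derivative exists and belongs to $B^0_p$. $\mathfrak{M}$ is the set of convex (downward), continuous functions $\psi(t)$, $t\ge1$, with $\psi(t)\to0$ as $t\to\infty$; the sequence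 $\psi(k)$ defining the class is the restriction of $\psi\in\mathfrak{M}$ to $\mathbb{N}$. For $\psi\in\mathfrak{M}$, $\eta(t)=\eta(\psi;t)=\psi^{-1}(\psi(t)/2)$ and $\mu(t)=\mu(\psi;t)=\frac{t}{\eta(t)-t}$. $\mathfrak{M}^+_\infty=\{\psi\in\mathfrak{M}:\mu(\psi;t)\text{ increases monotonically to }\infty\}$, and $\mathfrak{M}''_\infty=\{\psi\in\mathfrak{M}^+_\infty:\exists K>0\text{ with }\eta(\psi;t)-t\ge K\ \forall t\ge1\}$. For $f\in L_1$, $1\le s\le\infty$, $m\in\mathbb{N}$: $e^{\bot}_m(f)_s=\inf_{\gamma_m}\|f-\sum_{k\in\gamma_m}\hat f(k)e^{ik\cdot}\|_s$, the infimum over all sets $\gamma_m$ of $m$ integers, and $e^{\bot}_m(L^{\psi}_{\beta,p})_s=\sup_{f\in L^{\psi}_{\beta,p}}e^{\bot}_m(f)_s$. $a_n\asymp b_n$ means $C_1a_n\le b_n\le C_2a_n$ for all $n$ with positive constants $C_1,C_2$ independent of $n$. *)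

theory Defs
  imports "HOL-Analysis.Analysis" "HOL-Probability.Essential_Supremum"
begin

definition periodic2pi :: "(real \<Rightarrow> 'a) \<Rightarrow> bool" where
  "periodic2pi f \<longleftrightarrow> (\<forall>x. f (x + 2 * pi) = f x)"

definition in_Lp :: "real \<Rightarrow> (real \<Rightarrow> real) \<Rightarrow> bool" where
  "in_Lp p f \<longleftrightarrow> periodic2pi f \<and> f \<in> borel_measurable lborel \<and>
     set_integrable lborel {0..2*pi} (\<lambda>x. \<bar>f x\<bar> powr p)"

definition Lp_norm :: "real \<Rightarrow> (real \<Rightarrow> real) \<Rightarrow> real" where
  "Lp_norm p f = (LINT x:{0..2*pi}|lborel. \<bar>f x\<bar> powr p) powr (1 / p)"

definition Linf_norm :: "(real \<Rightarrow> complex) \<Rightarrow> ereal" where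
  "Linf_norm g = esssup (restrict_space lborel {0..2*pi}) (\<lambda>x. ereal (cmod (g x)))"

definition fcoef :: "(real \<Rightarrow> real) \<Rightarrow> int \<Rightarrow> complex" where
  "fcoef f k = complex_of_real (1 / (2 * pi)) *
     (LINT t:{-pi..pi}|lborel. complex_of_real (f t) * cis (- (of_int k * t)))"

definition is_psi_beta_deriv ::
  "(real \<Rightarrow> real) \<Rightarrow> real \<Rightarrow> (real \<Rightarrow> real) \<Rightarrow> (real \<Rightarrow> real) \<Rightarrow> bool" where
  "is_psi_beta_deriv \<psi> \<beta> f \<phi> \<longleftrightarrow> in_Lp 1 \<phi> \<and>
     (\<forall>k::int. fcoef \<phi> k =
        (if k = 0 then 0
         else fcoef f k / complex_of_real (\<psi> (of_int \<bar>k\<bar>))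
              * cis (\<beta> * pi / 2 * of_int (sgn k))))"

definition L_class :: "(real \<Rightarrow> real) \<Rightarrow> real \<Rightarrow> real \<Rightarrow> (real \<Rightarrow> real) set" where
  "L_class \<psi> \<beta> p = {f. in_Lp 1 f \<and> (\<exists>\<phi>. is_psi_beta_deriv \<psi> \<beta> f \<phi> \<and>
      in_Lp p \<phi> \<and> Lp_norm p \<phi> \<le> 1 \<and> (LINT t:{-pi..pi}|lborel. \<phi> t) = 0)}"

definition e_orth_inf :: "nat \<Rightarrow> (real \<Rightarrow> real) \<Rightarrow> ereal" where
  "e_orth_inf m f = (INF \<gamma> \<in> {\<gamma>::int set. finite \<gamma> \<and> card \<gamma> = m}.
      Linf_norm (\<lambda>x. complex_of_real (f x) - (\<Sum>k\<in>\<gamma>. fcoef f k * cis (of_int k * x))))"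

definition e_orth_inf_class :: "nat \<Rightarrow> (real \<Rightarrow> real) set \<Rightarrow> ereal" where
  "e_orth_inf_class m F = (SUP f \<in> F. e_orth_inf m f)"

(* the set \<MM> (functions are considered on [1,\<infinity>); positivity is part of Stepanets' definition) *)
definition class_M :: "(real \<Rightarrow> real) \<Rightarrow> bool" where
  "class_M \<psi> \<longleftrightarrow> (\<forall>t\<ge>1. \<psi> t > 0) \<and> convex_on {1..} \<psi> \<and> continuous_on {1..} \<psi> \<and>
     (\<psi> \<longlongrightarrow> 0) at_top"

definition eta :: "(real \<Rightarrow> real) \<Rightarrow> real \<Rightarrow> real" where
  "eta \<psi> t = (THE s. s \<ge> 1 \<and> \<psi> s = \<psi> t / 2)"

definition mu :: "(real \<Rightarrow> real) \<Rightarrow> real \<Rightarrow> real" where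
  "mu \<psi> t = t / (eta \<psi> t - t)"

definition class_M_plus_inf :: "(real \<Rightarrow> real) \<Rightarrow> bool" where
  "class_M_plus_inf \<psi> \<longleftrightarrow> class_M \<psi> \<and> mono_on {1..} (mu \<psi>) \<and>
     filterlim (mu \<psi>) at_top at_top"

definition class_M_pp_inf :: "(real \<Rightarrow> real) \<Rightarrow> bool" where
  "class_M_pp_inf \<psi> \<longleftrightarrow> class_M_plus_inf \<psi> \<and> (\<exists>K>0. \<forall>t\<ge>1. eta \<psi> t - t \<ge> K)"

definition asymp_eq :: "(nat \<Rightarrow> ereal) \<Rightarrow> (nat \<Rightarrow> ereal) \<Rightarrow> bool" where
  "asymp_eq a b \<longleftrightarrow> (\<exists>C1>0. \<exists>C2>0. \<forall>n\<ge>1.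
      ereal C1 * a n \<le> b n \<and> b n \<le> ereal C2 * a n)"

end

theory Submission
  imports Defs
begin

text \<open>
  Write \<open>h n = \<eta> n - n\<close>. Upper bound: take for \<open>\<gamma>\<close> the frequencies of modulus below \<open>n\<close>
  (plus \<open>n\<close> itself). The remainder is \<open>\<phi>\<close> convolved with the kernel
  \<open>\<Sum>k\<ge>n. \<psi> k cos (k u + \<beta> \<pi> / 2)\<close>, which is \<open>O (\<psi> n h n)\<close> because the tail sum of \<open>\<psi>\<close> is
  dominated by a geometric series over the blocks \<open>[\<eta>^j n, \<eta>^(j+1) n)\<close>, and is
  \<open>O (\<psi> n / \<bar>sin (u / 2)\<bar>)\<close> by Abel summation. Together these bound its norm in the conjugate space
  by a multiple of \<open>\<psi> n (h n)^(1/p)\<close>, and Hoelder's inequality applies.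

  Lower bound: the test function is \<open>f = d \<Sum>k=1..n+\<lceil>h n\<rceil>. cos (k t)\<close>, the phase \<open>\<beta>\<close> being absorbed in
  its derivative. Since all coefficients of \<open>f\<close> are equal and positive, deleting any \<open>2 n\<close> of them
  leaves a value of at least \<open>d h n\<close> at the origin. The derivative
  \<open>d \<Sum>k. cos (k t + \<beta> \<pi> / 2) / \<psi> k\<close> obeys the same two kernel estimates, now because the
  monotonicity of \<open>\<psi> / \<bar>\<psi>'\<bar>\<close> makes \<open>1 / \<psi> k\<close> decay geometrically as \<open>k\<close> decreases from \<open>n\<close>;
  so \<open>d\<close> may be chosen of order \<open>\<psi> n (h n)^(1/p-1)\<close>.
\<close>

section \<open>Rapidly decreasing convex functions\<close>

lemma class_M_pos: "class_M \<psi> \<Longrightarrow> 1 \<le> t \<Longrightarrow> 0 < \<psi> t"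
  by (simp add: class_M_def)

text \<open>A convex function that fails to decrease from \<open>x\<close> to \<open>y\<close> stays
  at least \<open>\<psi> y\<close> beyond \<open>y\<close>; as \<open>\<psi> y > 0\<close>, this
  contradicts the limit 0.\<close>

lemma class_M_strict_decreasing:
  assumes M: "class_M \<psi>" and x: "1 \<le> x" "x < y"
  shows "\<psi> y < \<psi> x"
proof (rule ccontr)
  assume "\<not> \<psi> y < \<psi> x"
  then have xy: "\<psi> x \<le> \<psi> y" by simp
  have ge: "\<psi> y \<le> \<psi> z" if z: "y < z" for z
  proof -
    define u where "u = (y - x) / (z - x)"
    have u: "0 < u" "u < 1" using x z by (auto simp: u_def)
    have "(1 - u) * x + u * z = x + u * (z - x)" by (simp add: algebra_simps)
    also have "\<dots> = y" using x z by (simp add: u_def)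
    finally have y: "(1 - u) * x + u * z = y" .
    have "convex_on {1..} \<psi>" using M by (simp add: class_M_def)
    then have "\<psi> ((1 - u) *\<^sub>R x + u *\<^sub>R z) \<le> (1 - u) * \<psi> x + u * \<psi> z"
      using u x z by (intro convex_onD) auto
    then have "\<psi> y \<le> (1 - u) * \<psi> x + u * \<psi> z" using y by simp
    also have "\<dots> \<le> (1 - u) * \<psi> y + u * \<psi> z"
      using xy u by (intro add_right_mono mult_left_mono) auto
    finally have "u * \<psi> y \<le> u * \<psi> z" by (simp add: algebra_simps)
    then show ?thesis using u by simp
  qed
  have "eventually (\<lambda>z. \<psi> y \<le> \<psi> z) at_top"
    using eventually_gt_at_top[of y] by eventually_elim (rule ge)
  moreover have "(\<psi> \<longlongrightarrow> 0) at_top" using M by (simp add: class_M_def)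
  ultimately have "\<psi> y \<le> 0"
    by (intro tendsto_lowerbound) auto
  moreover have "0 < \<psi> y" using class_M_pos[OF M, of y] x by simp
  ultimately show False by simp
qed

lemma class_M_decreasing:
  assumes "class_M \<psi>" "1 \<le> x" "x \<le> y"
  shows "\<psi> y \<le> \<psi> x"
  using class_M_strict_decreasing[OF assms(1,2), of y] assms(3) by (cases "x = y") auto

text \<open>\<open>eta\<close> is a definite description over all of [1, infinity). The limit 0 and
  the intermediate value theorem give a solution beyond \<open>t\<close>; strict decrease makes it
  the only one anywhere.\<close>

lemma
  assumes M: "class_M \<psi>" and t: "1 \<le> t"
  shows psi_eta: "\<psi> (eta \<psi> t) = \<psi> t / 2" and eta_gt: "t < eta \<psi> t"
proof -
  have pos: "0 < \<psi> t" using class_M_pos[OF M t] .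
  have "(\<psi> \<longlongrightarrow> 0) at_top" using M by (simp add: class_M_def)
  then have "eventually (\<lambda>z. \<psi> z < \<psi> t / 2) at_top"
    using pos by (intro order_tendstoD) auto
  then have "eventually (\<lambda>z. \<psi> z < \<psi> t / 2 \<and> t < z) at_top"
    using eventually_gt_at_top[of t] by eventually_elim auto
  then obtain z where z: "\<psi> z < \<psi> t / 2" "t < z"
    by (auto simp: eventually_at_top_linorder)
  have "continuous_on {t..z} \<psi>"
    using M t unfolding class_M_def by (metis atLeast_iff atLeastAtMost_iff continuous_on_subset order_trans subsetI)
  then have "\<exists>s\<ge>t. s \<le> z \<and> \<psi> s = \<psi> t / 2"
    using z pos by (intro IVT2') auto
  then obtain s where s: "t \<le> s" "\<psi> s = \<psi> t / 2" by auto
  have e: "eta \<psi> t = s" unfolding eta_def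
  proof (rule the_equality)
    show "1 \<le> s \<and> \<psi> s = \<psi> t / 2" using s t by simp
    show "r = s" if "1 \<le> r \<and> \<psi> r = \<psi> t / 2" for r
      using class_M_strict_decreasing[OF M, of r s] class_M_strict_decreasing[OF M, of s r] that s t
      by (cases r s rule: linorder_cases) auto
  qed
  show "\<psi> (eta \<psi> t) = \<psi> t / 2" using e s by simp
  show "t < eta \<psi> t" using e s pos by (cases "t = s") auto
qed

lemma card_nat_interval_le:
  assumes "0 \<le> s" "s \<le> T"
  shows "finite {k::nat. s \<le> real k \<and> real k < T}"
    and "real (card {k::nat. s \<le> real k \<and> real k < T}) \<le> T - s + 1"
proof -
  have sub: "{k::nat. s \<le> real k \<and> real k < T} \<subseteq> {nat \<lceil>s\<rceil>..<nat \<lceil>T\<rceil>}"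
    by (auto simp: nat_le_iff ceiling_le_iff zless_nat_eq_int_zless less_ceiling_iff)
  then show "finite {k::nat. s \<le> real k \<and> real k < T}" using finite_subset by blast
  have "card {k::nat. s \<le> real k \<and> real k < T} \<le> nat \<lceil>T\<rceil> - nat \<lceil>s\<rceil>"
    using card_mono[OF _ sub] by simp
  also have "real \<dots> \<le> T - s + 1"
  proof -
    have "nat \<lceil>s\<rceil> \<le> nat \<lceil>T\<rceil>" using assms by (intro nat_mono ceiling_mono)
    then show ?thesis using assms by (simp add: of_nat_diff) linarith
  qed
  finally show "real (card {k::nat. s \<le> real k \<and> real k < T}) \<le> T - s + 1" by simp
qed

text \<open>The uniform gap \<open>K\<close> drives the iterates to infinity, so finitely many
  blocks between consecutive iterates cover any finite range of indices.\<close>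

lemma eta_iterate_ge:
  assumes "class_M \<psi>" "\<And>t. 1 \<le> t \<Longrightarrow> K \<le> eta \<psi> t - t" "0 < K" "1 \<le> s"
  shows "s + real j * K \<le> (eta \<psi> ^^ j) s \<and> \<psi> ((eta \<psi> ^^ j) s) = \<psi> s / 2 ^ j"
proof (induction j)
  case 0
  then show ?case by simp
next
  case (Suc j)
  have "1 \<le> (eta \<psi> ^^ j) s"
    using Suc assms(3,4) by (smt (verit) mult_nonneg_nonneg of_nat_0_le_iff)
  then show ?case
    using Suc assms(2)[of "(eta \<psi> ^^ j) s"] psi_eta[OF assms(1), of "(eta \<psi> ^^ j) s"]
    by (simp add: algebra_simps)
qed

text \<open>Since \<open>\<mu>\<close> increases and \<open>\<mu> s \<ge> 2\<close>, block lengths grow by at most \<open>3/2\<close> per block while \<open>\<psi>\<close> halves;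
  hence the constant \<open>4 = 1 / (1 - 3/4)\<close>.\<close>
lemma block_sum_le:
  assumes M: "class_M \<psi>" and mono: "mono_on {1..} (mu \<psi>)"
    and K: "\<And>t. 1 \<le> t \<Longrightarrow> K \<le> eta \<psi> t - t" "0 < K"
    and s: "1 \<le> s" "2 \<le> mu \<psi> s"
  shows "(\<Sum>k\<in>{k::nat. s \<le> real k \<and> real k < (eta \<psi> ^^ j) s}. \<psi> (real k))
    \<le> 4 * (1 + 1 / K) * \<psi> s * (eta \<psi> s - s)"
  using s
\<comment> \<open>The first block is split off and the hypothesis applied from its right end
  \<open>T\<close>, hence the generalisation over \<open>s\<close>. The condition
  \<open>2 \<le> mu \<psi> T\<close> is inherited by monotonicity.\<close>
proof (induction j arbitrary: s)
  case 0
  have "{k::nat. s \<le> real k \<and> real k < s} = {}" by auto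
  moreover have "0 \<le> 4 * (1 + 1 / K) * \<psi> s * (eta \<psi> s - s)"
    using class_M_pos[OF M, of s] eta_gt[OF M, of s] K(2) 0 by (intro mult_nonneg_nonneg) auto
  ultimately show ?case by (simp only: funpow_0 sum.empty)
next
  case (Suc j)
  define h where "h = eta \<psi> s - s"
  define T where "T = eta \<psi> s"
  define U where "U = (eta \<psi> ^^ j) T"
  define I where "I a b = {k::nat. a \<le> real k \<and> real k < b}" for a b
  have h: "K \<le> h" "0 < h" using K(1)[of s] K(2) Suc.prems by (auto simp: h_def)
  have T: "1 \<le> T" "s \<le> T" "T = s + h" using Suc.prems h by (auto simp: T_def h_def)
  have muT: "mu \<psi> s \<le> mu \<psi> T"
    using mono_onD[OF mono, of s T] T Suc.prems by simp
  have hT: "eta \<psi> T - T \<le> 3 / 2 * h"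
  proof -
    have pos: "0 < mu \<psi> s" "0 < mu \<psi> T" using Suc.prems muT by auto
    have hm: "h = s / mu \<psi> s" "eta \<psi> T - T = T / mu \<psi> T"
      using eta_gt[OF M, of s] eta_gt[OF M, of T] Suc.prems T by (auto simp: mu_def h_def)
    have "eta \<psi> T - T \<le> T / mu \<psi> s"
      unfolding hm(2) using muT pos T by (intro divide_left_mono) auto
    also have "\<dots> = h + h / mu \<psi> s" using T hm(1) by (simp add: add_divide_distrib)
    also have "\<dots> \<le> h + h / 2" using h Suc.prems by (intro add_left_mono divide_left_mono) auto
    finally show ?thesis by simp
  qed
  have TU: "T \<le> U"
    using eta_iterate_ge[OF M K T(1), of j] K(2) unfolding U_def by (smt (verit) mult_nonneg_nonneg of_nat_0_le_iff)
  have fin: "finite (I s T)" "finite (I T U)"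
    using card_nat_interval_le(1)[of s T] card_nat_interval_le(1)[of T U] Suc.prems T TU
    by (auto simp: I_def)
  have un: "I s U = I s T \<union> I T U" "I s T \<inter> I T U = {}"
    using T TU by (auto simp: I_def)
  have "(\<Sum>k\<in>I s T. \<psi> (real k)) \<le> (\<Sum>k\<in>I s T. \<psi> s)"
    using Suc.prems by (intro sum_mono class_M_decreasing[OF M]) (auto simp: I_def)
  also have "\<dots> = real (card (I s T)) * \<psi> s" by simp
  also have "\<dots> \<le> (h + 1) * \<psi> s"
    using card_nat_interval_le(2)[of s T] Suc.prems T class_M_pos[OF M, of s]
    by (intro mult_right_mono) (auto simp: I_def)
  \<comment> \<open>\<open>1 \<le> h / K\<close> turns the extra point of the count into a factor,
    which keeps the bound proportional to \<open>h\<close>.\<close>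
  also have "\<dots> \<le> (h * (1 + 1 / K)) * \<psi> s"
    using h K(2) class_M_pos[OF M, of s] Suc.prems
    by (intro mult_right_mono) (auto simp: field_simps)
  finally have 1: "(\<Sum>k\<in>I s T. \<psi> (real k)) \<le> (1 + 1 / K) * \<psi> s * h" by (simp add: mult_ac)
  have "(\<Sum>k\<in>I T U. \<psi> (real k)) \<le> 4 * (1 + 1 / K) * \<psi> T * (eta \<psi> T - T)"
    using Suc.IH[of T] T muT Suc.prems by (simp add: I_def U_def)
  also have "\<dots> \<le> 4 * (1 + 1 / K) * \<psi> T * (3 / 2 * h)"
    using hT K(2) class_M_pos[OF M, of T] T by (intro mult_left_mono) auto
  also have "\<psi> T = \<psi> s / 2" using psi_eta[OF M, of s] Suc.prems by (simp add: T_def)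
  finally have 2: "(\<Sum>k\<in>I T U. \<psi> (real k)) \<le> 3 * ((1 + 1 / K) * \<psi> s * h)" by (simp add: algebra_simps)
  \<comment> \<open>1 from the first block plus 4 * 1/2 * 3/2 = 3 from the rest restores the
    constant 4.\<close>
  have "(\<Sum>k\<in>I s U. \<psi> (real k)) \<le> 4 * ((1 + 1 / K) * \<psi> s * h)"
    using 1 2 unfolding un(1) by (subst sum.union_disjoint) (use fin un in auto)
  moreover have "U = (eta \<psi> ^^ Suc j) s" by (simp add: U_def T_def funpow_swap1)
  ultimately show ?case unfolding I_def h_def by (simp only: mult.assoc)
qed

text \<open>The block estimate needs \<open>2 \<le> mu \<psi> n\<close>, which is available only
  from some \<open>N\<close> on; the finitely many smaller \<open>n\<close> go into the constant.
  Uniformity in \<open>m\<close> later gives summability as well.\<close>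

lemma tail_sum_le:
  assumes "class_M_pp_inf \<psi>"
  shows "\<exists>C>0. \<forall>n\<ge>1. \<forall>m. (\<Sum>k=n..m. \<psi> (real k)) \<le> C * (\<psi> (real n) * (eta \<psi> (real n) - real n))"
proof -
  from assms have M: "class_M \<psi>" and mono: "mono_on {1..} (mu \<psi>)"
    and lim: "filterlim (mu \<psi>) at_top at_top"
    by (auto simp: class_M_pp_inf_def class_M_plus_inf_def)
  from assms obtain K where K: "0 < K" "\<And>t. 1 \<le> t \<Longrightarrow> K \<le> eta \<psi> t - t"
    by (auto simp: class_M_pp_inf_def)
  have "eventually (\<lambda>t. 2 \<le> mu \<psi> t) at_top" using lim by (simp add: filterlim_at_top)
  then obtain N0' where N0': "\<And>t. N0' \<le> t \<Longrightarrow> 2 \<le> mu \<psi> t"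
    by (auto simp: eventually_at_top_linorder)
  define N where "N = nat \<lceil>max N0' 1\<rceil>"
  have N: "1 \<le> N" "N0' \<le> real N" unfolding N_def by linarith+
  define A where "A = 4 * (1 + 1 / K)"
  have A: "0 < A" using K by (auto simp: A_def intro!: add_pos_pos)
  define h where "h n = eta \<psi> (real n) - real n" for n :: nat
  have large: "(\<Sum>k=n..m. \<psi> (real k)) \<le> A * (\<psi> (real n) * h n)" if n: "N \<le> n" for n m
  proof -
    obtain j :: nat where "real m < real j * K" using reals_Archimedean3[OF K(1)] by blast
    then have mj: "real m < (eta \<psi> ^^ j) (real n)"
      using eta_iterate_ge[OF M K(2) K(1), of "real n" j] n N by auto
    have "(\<Sum>k=n..m. \<psi> (real k))
      \<le> (\<Sum>k\<in>{k::nat. real n \<le> real k \<and> real k < (eta \<psi> ^^ j) (real n)}. \<psi> (real k))"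
    proof (rule sum_mono2)
      show "finite {k. real n \<le> real k \<and> real k < (eta \<psi> ^^ j) (real n)}"
        using card_nat_interval_le(1)[of "real n" "(eta \<psi> ^^ j) (real n)"]
          eta_iterate_ge[OF M K(2) K(1), of "real n" j] n N K(1)
        by (smt (verit) mult_nonneg_nonneg of_nat_0_le_iff of_nat_le_iff of_nat_1)
      show "{n..m} \<subseteq> {k. real n \<le> real k \<and> real k < (eta \<psi> ^^ j) (real n)}"
        using mj by auto
      show "0 \<le> \<psi> (real k)" if "k \<in> {k. real n \<le> real k \<and> real k < (eta \<psi> ^^ j) (real n)} - {n..m}" for k
        using that n N(1) class_M_pos[OF M, of "real k"] by simp
    qed
    also have "\<dots> \<le> A * \<psi> (real n) * h n"
      unfolding A_def h_def
      using n N N0'[of "real n"] by (intro block_sum_le[OF M mono K(2) K(1)]) auto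
    finally show ?thesis by (simp add: mult_ac)
  qed
  \<comment> \<open>Bounds every sum that starts below \<open>N\<close>: at most \<open>N\<close>
    terms of size at most \<open>\<psi> 1\<close>, then the tail from \<open>N\<close> on.\<close>
  define D where "D = real N * \<psi> 1 + A * (\<psi> (real N) * h N)"
  have hK: "K \<le> h n" if "1 \<le> n" for n using K(2)[of "real n"] that by (simp add: h_def)
  have D: "0 < D" unfolding D_def using N A K class_M_pos[OF M] hK[of N]
    by (intro add_pos_pos mult_pos_pos) auto
  have small: "(\<Sum>k=n..m. \<psi> (real k)) \<le> D" if n: "1 \<le> n" "n < N" for n m
  proof -
    have "(\<Sum>k=n..m. \<psi> (real k)) \<le> (\<Sum>k\<in>{n..<N} \<union> {N..m}. \<psi> (real k))"
    proof (rule sum_mono2)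
      show "0 \<le> \<psi> (real k)" if "k \<in> {n..<N} \<union> {N..m} - {n..m}" for k
      proof -
        have "1 \<le> k" using that n by auto
        then show ?thesis using class_M_pos[OF M, of "real k"] by simp
      qed
    qed auto
    also have "\<dots> = (\<Sum>k\<in>{n..<N}. \<psi> (real k)) + (\<Sum>k\<in>{N..m}. \<psi> (real k))"
      by (rule sum.union_disjoint) auto
    also have "(\<Sum>k\<in>{n..<N}. \<psi> (real k)) \<le> (\<Sum>k\<in>{n..<N}. \<psi> 1)"
      using n by (intro sum_mono class_M_decreasing[OF M]) auto
    also have "\<dots> = real (N - n) * \<psi> 1" by simp
    also have "\<dots> \<le> real N * \<psi> 1"
      using class_M_pos[OF M, of 1] by (intro mult_right_mono) auto
    finally show ?thesis unfolding D_def using large[of N m] by simp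
  qed
  have main: "(\<Sum>k=n..m. \<psi> (real k)) \<le> (A + D / (\<psi> (real N) * K)) * (\<psi> (real n) * h n)"
    if n: "1 \<le> n" for n m
  proof -
    have pos: "0 < \<psi> (real n)" "0 < \<psi> (real N)" using n N class_M_pos[OF M] by auto
    have hp: "0 < h n" using hK[OF n] K by simp
    show ?thesis
    proof (cases "N \<le> n")
      case True
      then show ?thesis using large[OF True, of m] pos hp D K
        by (smt (verit) mult_nonneg_nonneg divide_nonneg_pos mult_pos_pos distrib_right)
    next
      case False
      \<comment> \<open>A positive lower bound for the right-hand side over all
        \<open>n < N\<close>, so that the fixed number \<open>D\<close> is at most a fixed multiple
        of it.\<close>
      have "\<psi> (real N) * K \<le> \<psi> (real n) * h n"
        using False n pos K hK[OF n] by (intro mult_mono class_M_decreasing[OF M]) auto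
      then have "D * (\<psi> (real N) * K) \<le> D * (\<psi> (real n) * h n)"
        using D by (intro mult_left_mono) auto
      then have "D \<le> D / (\<psi> (real N) * K) * (\<psi> (real n) * h n)"
        using pos K by (simp add: field_simps)
      moreover have "0 < A * (\<psi> (real n) * h n)" using A pos hp by simp
      ultimately show ?thesis using small[OF n, of m] False by (simp add: distrib_right)
    qed
  qed
  show ?thesis
  proof (intro exI conjI allI impI)
    show "0 < A + D / (\<psi> (real N) * K)"
      using A D K class_M_pos[OF M, of N] N by (intro add_pos_pos divide_pos_pos) auto
    show "(\<Sum>k=n..m. \<psi> (real k)) \<le> (A + D / (\<psi> (real N) * K)) * (\<psi> (real n) * (eta \<psi> (real n) - real n))"
      if "1 \<le> n" for n m using main[OF that, of m] by (simp add: h_def)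
  qed
qed

text \<open>Rounding up passes \<open>eta \<psi> n\<close> by at most 1. With
  \<open>j * K > 1\<close>, another \<open>j\<close> iterations of \<open>eta\<close> cover that
  unit, and each costs a factor 1/2. This keeps \<open>\<psi>\<close> at the degree of the test
  polynomial comparable with \<open>\<psi> n\<close>.\<close>

lemma psi_shift_ge:
  assumes "class_M_pp_inf \<psi>"
  shows "\<exists>c>0. \<forall>n\<ge>1. c * \<psi> (real n) \<le> \<psi> (real (n + nat \<lceil>eta \<psi> (real n) - real n\<rceil>))"
proof -
  from assms have M: "class_M \<psi>" by (auto simp: class_M_pp_inf_def class_M_plus_inf_def)
  from assms obtain K where K: "0 < K" "\<And>t. 1 \<le> t \<Longrightarrow> K \<le> eta \<psi> t - t"
    by (auto simp: class_M_pp_inf_def)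
  obtain j :: nat where j: "1 < real j * K" using reals_Archimedean3[OF K(1)] by blast
  have "1 / 2 ^ Suc j * \<psi> (real n) \<le> \<psi> (real (n + nat \<lceil>eta \<psi> (real n) - real n\<rceil>))" if n: "1 \<le> n" for n
  proof -
    have e: "real n < eta \<psi> (real n)" using eta_gt[OF M] n by simp
    have "real (n + nat \<lceil>eta \<psi> (real n) - real n\<rceil>) \<le> eta \<psi> (real n) + 1"
      using e by (simp add: of_nat_nat) linarith
    also have "\<dots> \<le> (eta \<psi> ^^ j) (eta \<psi> (real n))"
      using eta_iterate_ge[OF M K(2) K(1), of "eta \<psi> (real n)" j] e n j by simp
    finally have "\<psi> ((eta \<psi> ^^ j) (eta \<psi> (real n))) \<le> \<psi> (real (n + nat \<lceil>eta \<psi> (real n) - real n\<rceil>))"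
      using n by (intro class_M_decreasing[OF M]) auto
    moreover have "\<psi> ((eta \<psi> ^^ j) (eta \<psi> (real n))) = \<psi> (real n) / 2 / 2 ^ j"
      using eta_iterate_ge[OF M K(2) K(1), of "eta \<psi> (real n)" j] psi_eta[OF M, of "real n"] e n by simp
    ultimately show ?thesis by simp
  qed
  then show ?thesis by (intro exI[of _ "1 / 2 ^ Suc j"]) auto
qed

section \<open>The logarithmic derivative of \<psi>\<close>

text \<open>Mean value theorem for \<open>ln \<psi>\<close>. Strict decrease forces
  \<open>\<psi>' \<xi> < 0\<close> at the intermediate point; the recorded positivity excludes the
  value 0 that division by zero would give.\<close>

lemma ln_psi_mvt:
  assumes M: "class_M \<psi>"
    and d: "\<And>t. t \<ge> 1 \<Longrightarrow> (\<psi> has_real_derivative \<psi>' t) (at t within {1..})"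
    and x: "1 \<le> x" "x < y"
  shows "\<exists>\<xi>. x < \<xi> \<and> \<xi> < y \<and> 0 < \<psi> \<xi> / \<bar>\<psi>' \<xi>\<bar> \<and> ln (\<psi> x) - ln (\<psi> y) = (y - x) / (\<psi> \<xi> / \<bar>\<psi>' \<xi>\<bar>)"
proof -
  have "\<exists>\<xi>\<in>{x<..<y}. ln (\<psi> y) - ln (\<psi> x) = ((*) (1 / \<psi> \<xi> * \<psi>' \<xi>)) (y - x)"
  proof (rule mvt_simple[OF x(2)])
    fix t assume t: "x \<le> t" "t \<le> y"
    have "(\<psi> has_real_derivative \<psi>' t) (at t within {x..y})"
      using d[of t] t x by (intro has_field_derivative_subset[where t="{x..y}" and s="{1..}"]) auto
    then have "((\<lambda>t. ln (\<psi> t)) has_real_derivative 1 / \<psi> t * \<psi>' t) (at t within {x..y})"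
      using class_M_pos[OF M, of t] t x by (intro DERIV_chain2[where f=ln and g=\<psi>] DERIV_ln_divide) auto
    then show "((\<lambda>t. ln (\<psi> t)) has_derivative ((*) (1 / \<psi> t * \<psi>' t))) (at t within {x..y})"
      by (simp only: has_field_derivative_def)
  qed
  then obtain \<xi> where \<xi>: "x < \<xi>" "\<xi> < y" "ln (\<psi> y) - ln (\<psi> x) = \<psi>' \<xi> / \<psi> \<xi> * (y - x)" by auto
  have pos: "0 < \<psi> \<xi>" "0 < \<psi> y" "0 < \<psi> x" using class_M_pos[OF M] \<xi> x by auto
  have "ln (\<psi> y) < ln (\<psi> x)" using class_M_strict_decreasing[OF M x] pos by simp
  then have "\<psi>' \<xi> / \<psi> \<xi> * (y - x) < 0" using \<xi> by simp
  then have "\<psi>' \<xi> < 0" using pos x by (auto simp: mult_less_0_iff divide_less_0_iff)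
  then show ?thesis using \<xi> pos by (intro exI[of _ \<xi>]) (auto simp: field_simps)
qed

text \<open>On [n, \<open>eta \<psi> n\<close>] the function \<open>- ln \<psi>\<close> has mean
  slope \<open>x\<close>. Its slope is the reciprocal of an increasing function, so to the left of
  \<open>n\<close> it is at least \<open>x\<close>. The ratios are thus dominated by powers of
  \<open>exp (- x)\<close>, and the geometric series is at most 1 + 1/x.\<close>

lemma psi_ratio_sum_le:
  assumes M: "class_M \<psi>"
    and d: "\<And>t. t \<ge> 1 \<Longrightarrow> (\<psi> has_real_derivative \<psi>' t) (at t within {1..})"
    and mono: "mono_on {1..} (\<lambda>t. \<psi> t / \<bar>\<psi>' t\<bar>)"
    and n: "1 \<le> n"
  shows "(\<Sum>k=1..n. \<psi> (real n) / \<psi> (real k)) \<le> 1 + (eta \<psi> (real n) - real n) / ln 2"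
proof -
  define h where "h = eta \<psi> (real n) - real n"
  define x where "x = ln 2 / h"
  have h: "0 < h" using eta_gt[OF M, of "real n"] n by (simp add: h_def)
  then have x: "0 < x" by (simp add: x_def)
  obtain \<xi> where \<xi>: "real n < \<xi>" "0 < \<psi> \<xi> / \<bar>\<psi>' \<xi>\<bar>"
    "ln (\<psi> (real n)) - ln (\<psi> (eta \<psi> (real n))) = h / (\<psi> \<xi> / \<bar>\<psi>' \<xi>\<bar>)"
    using ln_psi_mvt[OF M d, of "real n" "eta \<psi> (real n)"] eta_gt[OF M, of "real n"] n
    unfolding h_def by auto
  have "ln (\<psi> (real n)) - ln (\<psi> (eta \<psi> (real n))) = ln 2"
    using psi_eta[OF M, of "real n"] class_M_pos[OF M, of "real n"] n
    by (simp add: ln_div del: eq_divide_eq_numeral1)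
  then have "ln 2 = h * (1 / (\<psi> \<xi> / \<bar>\<psi>' \<xi>\<bar>))" using \<xi>(3) by simp
  then have x_eq: "x = 1 / (\<psi> \<xi> / \<bar>\<psi>' \<xi>\<bar>)" using h unfolding x_def by (metis nonzero_mult_div_cancel_left less_irrefl)
  have term_le: "\<psi> (real n) / \<psi> (real k) \<le> exp (- x) ^ (n - k)" if k: "k \<in> {1..n}" for k
  proof (cases "k = n")
    case True
    then show ?thesis using class_M_pos[OF M, of "real n"] n by simp
  next
    case False
    then obtain \<zeta> where \<zeta>: "real k < \<zeta>" "\<zeta> < real n" "0 < \<psi> \<zeta> / \<bar>\<psi>' \<zeta>\<bar>"
      "ln (\<psi> (real k)) - ln (\<psi> (real n)) = (real n - real k) / (\<psi> \<zeta> / \<bar>\<psi>' \<zeta>\<bar>)"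
      using ln_psi_mvt[OF M d, of "real k" "real n"] k by auto
    \<comment> \<open>The two intermediate points satisfy \<open>\<zeta> < n < \<xi>\<close>; here
      the monotonicity hypothesis enters.\<close>
    have "\<psi> \<zeta> / \<bar>\<psi>' \<zeta>\<bar> \<le> \<psi> \<xi> / \<bar>\<psi>' \<xi>\<bar>"
      using mono_onD[OF mono, of \<zeta> \<xi>] \<zeta> \<xi> k by auto
    then have "(real n - real k) / (\<psi> \<xi> / \<bar>\<psi>' \<xi>\<bar>) \<le> ln (\<psi> (real k)) - ln (\<psi> (real n))"
      unfolding \<zeta>(4) using \<zeta>(3) \<xi>(2) k by (intro divide_left_mono mult_pos_pos) auto
    then have le: "ln (\<psi> (real n)) - ln (\<psi> (real k)) \<le> - (real (n - k) * x)"
      using k by (simp add: x_eq of_nat_diff)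
    have pos: "0 < \<psi> (real n)" "0 < \<psi> (real k)" using class_M_pos[OF M] n k by auto
    then have "\<psi> (real n) / \<psi> (real k) = exp (ln (\<psi> (real n)) - ln (\<psi> (real k)))"
      by (simp add: exp_diff)
    also have "\<dots> \<le> exp (- (real (n - k) * x))" using le by simp
    also have "\<dots> = exp (- x) ^ (n - k)"
      by (simp flip: exp_of_nat_mult)
    finally show ?thesis .
  qed
  define r where "r = exp (- x)"
  \<comment> \<open>Replaces \<open>exp (- x)\<close> by 1 / (1 + x), for which the geometric sum is
    exactly 1 + 1/x.\<close>
  have "1 + x \<le> exp x" by simp
  then have "exp (- x) \<le> 1 / (1 + x)" using x by (simp add: exp_minus field_simps)
  then have r: "0 < r" "r \<le> 1 / (1 + x)" by (auto simp: r_def)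
  then have r1: "r < 1" using x by (smt (verit) divide_less_eq_1)
  have "(\<Sum>k=1..n. \<psi> (real n) / \<psi> (real k)) \<le> (\<Sum>k=1..n. r ^ (n - k))"
    unfolding r_def by (rule sum_mono[OF term_le])
  also have "\<dots> = (\<Sum>i<n. r ^ i)"
    by (rule sum.reindex_bij_witness[where i="\<lambda>i. n - i" and j="\<lambda>k. n - k"]) auto
  also have "\<dots> = (1 - r ^ n) / (1 - r)" using r1 by (simp add: sum_gp_strict)
  also have "\<dots> \<le> 1 / (1 - r)" using r r1 by (intro divide_right_mono) auto
  also have "\<dots> \<le> 1 / (1 - 1 / (1 + x))" 
  proof -
    have "0 < 1 - 1 / (1 + x)" using x by (simp add: field_simps)
    then show ?thesis using r r1 by (intro divide_left_mono mult_pos_pos) auto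
  qed
  also have "\<dots> = 1 + 1 / x" using x by (simp add: field_simps)
  finally show ?thesis by (simp add: x_def h_def)
qed

section \<open>Abel summation and norms of peaked kernels\<close>

text \<open>Summation by parts moves the differences from \<open>b\<close> to \<open>c\<close>,
  whose total variation is at most \<open>c n\<close>; the boundary terms supply the other
  \<open>c n\<close>.\<close>

lemma abel_sum_le_decreasing:
  fixes b c :: "nat \<Rightarrow> real"
  assumes c: "\<And>i j. n \<le> i \<Longrightarrow> i \<le> j \<Longrightarrow> c j \<le> c i" "\<And>i. n \<le> i \<Longrightarrow> 0 \<le> c i"
    and b: "\<And>k. \<bar>b k\<bar> \<le> 1"
  shows "\<bar>\<Sum>k=n..m. c k * (b (Suc k) - b k)\<bar> \<le> 2 * c n"
proof (cases "n \<le> m")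
  case True
  \<comment> \<open>With the upper boundary term subtracted the claim is stable under induction:
    \<open>c n\<close> from the lower boundary plus the variation \<open>c n - c m\<close>.\<close>
  then have "\<bar>(\<Sum>k=n..m. c k * (b (Suc k) - b k)) - c m * b (Suc m)\<bar> \<le> 2 * c n - c m"
  proof (induction m rule: dec_induct)
    case base
    show ?case using b[of n] c(2)[of n] by (simp add: algebra_simps abs_mult mult_left_le)
  next
    case (step m)
    have "(\<Sum>k=n..Suc m. c k * (b (Suc k) - b k)) - c (Suc m) * b (Suc (Suc m))
      = ((\<Sum>k=n..m. c k * (b (Suc k) - b k)) - c m * b (Suc m)) + (c m - c (Suc m)) * b (Suc m)"
      using step by (simp add: algebra_simps)
    moreover have "\<bar>(c m - c (Suc m)) * b (Suc m)\<bar> \<le> c m - c (Suc m)"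
      using b[of "Suc m"] c(1)[of m "Suc m"] step by (simp add: abs_mult mult_left_le)
    ultimately show ?case using step.IH by linarith
  qed
  moreover have "\<bar>c m * b (Suc m)\<bar> \<le> c m"
    using b[of "Suc m"] c(2)[of m] True by (simp add: abs_mult mult_left_le)
  ultimately show ?thesis by linarith
qed (use c(2)[of n] in simp)

text \<open>The lower boundary term \<open>c n\<close> and the variation \<open>c l - c n\<close>
  add up to \<open>c l\<close>, so now the last coefficient governs the sum.\<close>

lemma abel_sum_le_increasing:
  fixes b c :: "nat \<Rightarrow> real"
  assumes nm: "n \<le> m"
    and c: "\<And>i j. n \<le> i \<Longrightarrow> i \<le> j \<Longrightarrow> j \<le> m \<Longrightarrow> c i \<le> c j" "0 \<le> c n"
    and b: "\<And>k. \<bar>b k\<bar> \<le> 1"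
  shows "\<bar>\<Sum>k=n..m. c k * (b (Suc k) - b k)\<bar> \<le> 2 * c m"
proof -
  \<comment> \<open>The premise \<open>l \<le> m\<close> stays inside the claim because
    \<open>c\<close> is known to increase only up to \<open>m\<close>.\<close>
  have "l \<le> m \<longrightarrow> \<bar>(\<Sum>k=n..l. c k * (b (Suc k) - b k)) - c l * b (Suc l)\<bar> \<le> c l" if "n \<le> l" for l
    using that
  proof (induction l rule: dec_induct)
    case base
    show ?case using b[of n] c(2) by (simp add: algebra_simps abs_mult mult_left_le)
  next
    case (step l)
    have "(\<Sum>k=n..Suc l. c k * (b (Suc k) - b k)) - c (Suc l) * b (Suc (Suc l))
      = ((\<Sum>k=n..l. c k * (b (Suc k) - b k)) - c l * b (Suc l)) + (c l - c (Suc l)) * b (Suc l)"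
      using step by (simp add: algebra_simps)
    moreover have "Suc l \<le> m \<Longrightarrow> \<bar>(c l - c (Suc l)) * b (Suc l)\<bar> \<le> c (Suc l) - c l"
      using b[of "Suc l"] c(1)[of l "Suc l"] step by (simp add: abs_mult mult_left_le)
    ultimately show ?case using step.IH by fastforce
  qed
  then have "\<bar>(\<Sum>k=n..m. c k * (b (Suc k) - b k)) - c m * b (Suc m)\<bar> \<le> c m" using nm by blast
  moreover have "\<bar>c m * b (Suc m)\<bar> \<le> c m"
    using b[of "Suc m"] c(1)[of n m] c(2) nm by (simp add: abs_mult mult_left_le)
  ultimately show ?thesis by linarith
qed

text \<open>Multiplying by 2 sin (u/2) turns each cosine into a difference of consecutive sines, the
  form required for Abel summation. The product form avoids dividing by a sine that may
  vanish.\<close>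

lemma cos_sum_times_sin_half:
  fixes c :: "nat \<Rightarrow> real"
  shows "2 * ((\<Sum>k=n..m. c k * cos (real k * u + \<theta>)) * sin (u / 2))
    = (\<Sum>k=n..m. c k * (sin ((real (Suc k) - 1 / 2) * u + \<theta>) - sin ((real k - 1 / 2) * u + \<theta>)))"
proof -
  have "2 * (cos (real k * u + \<theta>) * sin (u / 2))
    = sin ((real (Suc k) - 1 / 2) * u + \<theta>) - sin ((real k - 1 / 2) * u + \<theta>)" for k
  proof -
    have "(real (Suc k) - 1 / 2) * u + \<theta> = (real k * u + \<theta>) + u / 2"
      and "(real k - 1 / 2) * u + \<theta> = (real k * u + \<theta>) - u / 2"
      by (simp_all add: algebra_simps)
    then show ?thesis by (simp only: sin_add sin_diff)
  qed
  then have "2 * (c k * cos (real k * u + \<theta>) * sin (u / 2))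
    = c k * (sin ((real (Suc k) - 1 / 2) * u + \<theta>) - sin ((real k - 1 / 2) * u + \<theta>))" for k
    by (metis mult.assoc mult.left_commute)
  then show ?thesis unfolding sum_distrib_left sum_distrib_right by (intro sum.cong refl)
qed

text \<open>Serves the upper bound with coefficients \<open>\<psi> k\<close>; the increasing
  counterpart serves the lower bound with coefficients \<open>\<psi> n / \<psi> k\<close>.\<close>

lemma cos_sum_decreasing:
  fixes c :: "nat \<Rightarrow> real"
  assumes "\<And>i j. n \<le> i \<Longrightarrow> i \<le> j \<Longrightarrow> c j \<le> c i" "\<And>i. n \<le> i \<Longrightarrow> 0 \<le> c i"
  shows "\<bar>\<Sum>k=n..m. c k * cos (real k * u + \<theta>)\<bar> * \<bar>sin (u / 2)\<bar> \<le> c n"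
proof -
  have "\<bar>2 * ((\<Sum>k=n..m. c k * cos (real k * u + \<theta>)) * sin (u / 2))\<bar> \<le> 2 * c n"
    unfolding cos_sum_times_sin_half
    by (rule abel_sum_le_decreasing[where b="\<lambda>k. sin ((real k - 1 / 2) * u + \<theta>)"]) (use assms in auto)
  then show ?thesis by (simp add: abs_mult)
qed

lemma cos_sum_increasing:
  fixes c :: "nat \<Rightarrow> real"
  assumes "n \<le> m" "\<And>i j. n \<le> i \<Longrightarrow> i \<le> j \<Longrightarrow> j \<le> m \<Longrightarrow> c i \<le> c j" "0 \<le> c n"
  shows "\<bar>\<Sum>k=n..m. c k * cos (real k * u + \<theta>)\<bar> * \<bar>sin (u / 2)\<bar> \<le> c m"
proof -
  have "\<bar>2 * ((\<Sum>k=n..m. c k * cos (real k * u + \<theta>)) * sin (u / 2))\<bar> \<le> 2 * c m"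
    unfolding cos_sum_times_sin_half
    by (rule abel_sum_le_increasing[where b="\<lambda>k. sin ((real k - 1 / 2) * u + \<theta>)"]) (use assms in auto)
  then show ?thesis by (simp add: abs_mult)
qed

section \<open>Power integrals of peaked kernels and Hoelder's inequality\<close>

text \<open>Jordan's inequality: the concave sine lies above its chord from 0 to pi/2.\<close>

lemma sin_half_ge:
  assumes "0 \<le> t" "t \<le> pi"
  shows "t / pi \<le> sin (t / 2)"
proof -
  have "concave_on {0..pi} sin"
    by (rule f''_le0_imp_concave[where f'=cos and f''="\<lambda>x. - sin x"])
      (auto intro!: derivative_eq_intros sin_ge_zero)
  then have "(1 - t / pi) * sin 0 + t / pi * sin (pi / 2) \<le> sin ((1 - t / pi) *\<^sub>R 0 + (t / pi) *\<^sub>R (pi / 2))"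
    using assms by (intro concave_onD) auto
  then show ?thesis by simp
qed

text \<open>A peak of height \<open>M * H\<close> and width of order 1/H contributes order M^q
  H^(q-1), and the decay M/t outside it contributes no more because \<open>q > 1\<close>. The upper
  bound uses this with the conjugate exponent, the lower bound with \<open>p\<close> itself.\<close>

lemma peaked_powr_integral_le:
  assumes q: "1 < q" and H: "0 < H" and M: "0 \<le> M"
    and cont: "continuous_on UNIV g"
    and g1: "\<And>t. \<bar>g t\<bar> \<le> M * H" and g2: "\<And>t. \<bar>g t\<bar> * \<bar>sin (t / 2)\<bar> \<le> M"
  shows "(LINT t:{0..2*pi}|lborel. \<bar>g t\<bar> powr q)
    \<le> 2 * (1 + pi) powr q / (q - 1) * (M powr q * H powr (q - 1))"
proof -
  \<comment> \<open>The sine of t/2 vanishes at both ends of the interval, so a peak is allowed at 0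
    and at \<open>2 * pi\<close>; the second summand is the mirror image of the first.\<close>
  define B where "B t = (1 + H * t) powr (- q) + (1 + H * (2 * pi - t)) powr (- q)" for t
  define D where "D = M * (1 + pi) * H"
  have D: "0 \<le> D" using M H by (simp add: D_def)
  \<comment> \<open>The two bounds combine to the single smooth majorant \<open>a \<le> D / (1 + H * t)\<close>, which is integrated exactly.\<close>
  have half: "a powr q \<le> D powr q * (1 + H * t) powr (- q)"
    if t: "0 \<le> t" "t \<le> pi" and a: "0 \<le> a" "a \<le> M * H" "a * sin (t / 2) \<le> M" for a t
  proof -
    have "a * (t / pi) \<le> a * sin (t / 2)" using a sin_half_ge[OF t] by (intro mult_left_mono) auto
    then have "a * (t / pi) * pi \<le> M * pi" using a by (intro mult_right_mono) auto
    then have "a * t \<le> M * pi" by simp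
    then have "a + H * (a * t) \<le> M * H + H * (M * pi)" using a H by (intro add_mono mult_left_mono) auto
    then have "a * (1 + H * t) \<le> D" by (simp add: D_def algebra_simps)
    then have "a \<le> D / (1 + H * t)" using t H by (subst pos_le_divide_eq) (auto intro: add_pos_nonneg)
    then have "a powr q \<le> (D / (1 + H * t)) powr q" using a q by (intro powr_mono2) auto
    also have "\<dots> = D powr q * (1 + H * t) powr (- q)"
      using D t H by (simp add: powr_divide powr_minus_divide)
    finally show ?thesis .
  qed
  have ptw: "\<bar>g t\<bar> powr q \<le> D powr q * B t" if t: "t \<in> {0..2*pi}" for t
  proof -
    have nn: "0 \<le> D powr q * (1 + H * t) powr (- q)" "0 \<le> D powr q * (1 + H * (2 * pi - t)) powr (- q)"
      by auto
    show ?thesis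
    proof (cases "t \<le> pi")
      case True
      then have "0 \<le> sin (t / 2)" using t by (intro sin_ge_zero) auto
      then have "\<bar>g t\<bar> powr q \<le> D powr q * (1 + H * t) powr (- q)"
        using True t g1[of t] g2[of t] by (intro half) auto
      then show ?thesis using nn unfolding B_def distrib_left by linarith
    next
      case False
      have "sin ((2 * pi - t) / 2) = sin (t / 2)" by (simp add: diff_divide_distrib)
      moreover have "0 \<le> sin (t / 2)" using t by (intro sin_ge_zero) auto
      ultimately have "\<bar>g t\<bar> powr q \<le> D powr q * (1 + H * (2 * pi - t)) powr (- q)"
        using False t g1[of t] g2[of t] by (intro half) auto
      then show ?thesis using nn unfolding B_def distrib_left by linarith
    qed
  qed
  \<comment> \<open>An antiderivative of \<open>B\<close>. As 1 - q is negative, its powers at the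
    far ends only help, and the increment is at most 2 / (H (q - 1)).\<close>
  define F where "F t = ((1 + H * (2 * pi - t)) powr (1 - q) - (1 + H * t) powr (1 - q)) / (H * (q - 1))" for t
  have contB: "continuous_on {0..2*pi} B"
    unfolding B_def using H by (auto intro!: continuous_intros simp: add_nonneg_eq_0_iff)
  have intB: "(LINT t:{0..2*pi}|lborel. B t) = F (2 * pi) - F 0"
    unfolding set_lebesgue_integral_def
  proof (rule integral_FTC_atLeastAtMost)
    fix t assume t: "0 \<le> t" "t \<le> 2 * pi"
    have p: "0 < 1 + H * t" "0 < 1 + H * (2 * pi - t)" using H t by (auto intro: add_pos_nonneg)
    have "((\<lambda>t. (1 + H * t) powr (1 - q)) has_real_derivative (1 - q) * (1 + H * t) powr (1 - q - 1) * H) (at t)"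
      using p(1) by (intro DERIV_fun_powr[where r="1 - q" and g="\<lambda>t. 1 + H * t", simplified of_nat_1]) (auto intro!: derivative_eq_intros)
    moreover have "((\<lambda>t. (1 + H * (2 * pi - t)) powr (1 - q)) has_real_derivative
        (1 - q) * (1 + H * (2 * pi - t)) powr (1 - q - 1) * (- H)) (at t)"
      using p(2) by (intro DERIV_fun_powr[where r="1 - q" and g="\<lambda>t. 1 + H * (2 * pi - t)", simplified of_nat_1]) (auto intro!: derivative_eq_intros)
    ultimately have "(F has_real_derivative ((1 - q) * (1 + H * (2 * pi - t)) powr (1 - q - 1) * (- H)
        - (1 - q) * (1 + H * t) powr (1 - q - 1) * H) / (H * (q - 1))) (at t)"
      unfolding F_def by (intro DERIV_cdivide DERIV_diff)
    also have "((1 - q) * (1 + H * (2 * pi - t)) powr (1 - q - 1) * (- H)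
        - (1 - q) * (1 + H * t) powr (1 - q - 1) * H) / (H * (q - 1))
      = (H * (q - 1) * B t) / (H * (q - 1))"
      by (simp add: B_def algebra_simps)
    also have "\<dots> = B t" using H q by simp
    finally have "(F has_real_derivative B t) (at t)" .
    then show "(F has_vector_derivative B t) (at t within {0..2 * pi})"
      by (simp add: has_real_derivative_iff_has_vector_derivative has_vector_derivative_at_within)
  qed (use contB in auto)
  have "F (2 * pi) - F 0 = (2 - 2 * (1 + H * (2 * pi)) powr (1 - q)) / (H * (q - 1))"
    by (simp add: F_def diff_divide_distrib)
  also have "\<dots> \<le> 2 / (H * (q - 1))" using H q by (intro divide_right_mono) auto
  finally have FB: "F (2 * pi) - F 0 \<le> 2 / (H * (q - 1))" .
  have "(LINT t:{0..2*pi}|lborel. \<bar>g t\<bar> powr q) \<le> (LINT t:{0..2*pi}|lborel. D powr q * B t)"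
  proof (rule set_integral_mono)
    show "set_integrable lborel {0..2*pi} (\<lambda>t. \<bar>g t\<bar> powr q)"
      using q by (intro borel_integrable_atLeastAtMost' continuous_on_powr' continuous_on_const
          continuous_on_rabs continuous_on_subset[OF cont]) auto
    show "set_integrable lborel {0..2*pi} (\<lambda>t. D powr q * B t)"
      by (intro borel_integrable_atLeastAtMost' continuous_intros contB)
  qed (use ptw in auto)
  also have "\<dots> = D powr q * (F (2 * pi) - F 0)" by (simp add: intB)
  also have "\<dots> \<le> D powr q * (2 / (H * (q - 1)))" by (intro mult_left_mono FB) auto
  also have "D powr q = M powr q * (1 + pi) powr q * H powr q"
    using M H by (simp add: D_def powr_mult)
  also have "H powr q = H powr (q - 1) * H" using H powr_add[of H "q - 1" 1] by simp
  also have "M powr q * (1 + pi) powr q * (H powr (q - 1) * H) * (2 / (H * (q - 1)))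
    = 2 * (1 + pi) powr q / (q - 1) * (M powr q * H powr (q - 1))"
    using H by simp
  finally show ?thesis .
qed

text \<open>Young's inequality is applied pointwise to |f| and |g| / L; after integration the two
  parts sum to L (1/p + 1/q) = L.\<close>

lemma Holder_bound:
  fixes f g :: "real \<Rightarrow> real"
  assumes pq: "1 < p" "1 < q" "1 / p + 1 / q = 1"
    and f: "set_integrable lborel A (\<lambda>x. \<bar>f x\<bar> powr p)" "(LINT x:A|lborel. \<bar>f x\<bar> powr p) \<le> 1"
    and g: "set_integrable lborel A (\<lambda>x. \<bar>g x\<bar> powr q)" "(LINT x:A|lborel. \<bar>g x\<bar> powr q) \<le> L powr q"
    and L: "0 < L"
    and fg: "set_integrable lborel A (\<lambda>x. f x * g x)"
  shows "\<bar>LINT x:A|lborel. f x * g x\<bar> \<le> L"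
proof -
  have ptw: "\<bar>f x * g x\<bar> \<le> L * (1 / p * \<bar>f x\<bar> powr p + 1 / (q * L powr q) * \<bar>g x\<bar> powr q)" for x
  proof -
    have "\<bar>f x\<bar> * (\<bar>g x\<bar> / L) \<le> \<bar>f x\<bar> powr p / p + (\<bar>g x\<bar> / L) powr q / q"
      using pq L by (intro Youngs_inequality) auto
    also have "(\<bar>g x\<bar> / L) powr q = \<bar>g x\<bar> powr q / L powr q" using L by (simp add: powr_divide)
    finally have "L * (\<bar>f x\<bar> * (\<bar>g x\<bar> / L)) \<le> L * (\<bar>f x\<bar> powr p / p + \<bar>g x\<bar> powr q / L powr q / q)"
      using L by (intro mult_left_mono) auto
    then show ?thesis using L by (simp add: abs_mult mult_ac)
  qed
  have int: "set_integrable lborel A (\<lambda>x. L * (1 / p * \<bar>f x\<bar> powr p + 1 / (q * L powr q) * \<bar>g x\<bar> powr q))"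
    using f(1) g(1) by (intro set_integrable_mult_right set_integral_add) auto
  have "\<bar>LINT x:A|lborel. f x * g x\<bar> \<le> (LINT x:A|lborel. \<bar>f x * g x\<bar>)"
    using integral_abs_bound[of lborel "\<lambda>x. indicator A x *\<^sub>R (f x * g x)"]
    by (simp add: set_lebesgue_integral_def abs_mult)
  also have "\<dots> \<le> (LINT x:A|lborel. L * (1 / p * \<bar>f x\<bar> powr p + 1 / (q * L powr q) * \<bar>g x\<bar> powr q))"
    using fg int ptw by (intro set_integral_mono set_integrable_abs) auto
  also have "\<dots> = L * (1 / p * (LINT x:A|lborel. \<bar>f x\<bar> powr p) + 1 / (q * L powr q) * (LINT x:A|lborel. \<bar>g x\<bar> powr q))"
    using f(1) g(1) by (simp add: set_integral_add)
  also have "\<dots> \<le> L * (1 / p * 1 + 1 / (q * L powr q) * L powr q)"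
    using f(2) g(2) L pq by (intro mult_left_mono add_mono) auto
  also have "\<dots> = L" using pq L by simp
  finally show ?thesis .
qed

section \<open>Uniqueness of Fourier coefficients of integrable functions\<close>

lemma set_integrable_mult_bounded:
  fixes F u :: "real \<Rightarrow> 'a::{real_normed_div_algebra,banach,second_countable_topology}"
  assumes F: "set_integrable lborel A F" and u: "u \<in> borel_measurable borel"
    and B: "\<And>x. norm (u x) \<le> B"
  shows "set_integrable lborel A (\<lambda>x. F x * u x)"
proof -
  have i: "integrable lborel (\<lambda>x. indicator A x *\<^sub>R F x)" using F by (simp add: set_integrable_def)
  note [measurable] = borel_measurable_integrable[OF i] u
  have m: "(\<lambda>x. (indicator A x *\<^sub>R F x) * u x) \<in> borel_measurable lborel" by measurable
  have "integrable lborel (\<lambda>x. (indicator A x *\<^sub>R F x) * u x)"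
  proof (rule Bochner_Integration.integrable_bound[OF _ m])
    show "integrable lborel (\<lambda>x. B *\<^sub>R (indicator A x *\<^sub>R F x))" using i by (rule integrable_scaleR_right)
    show "AE x in lborel. norm ((indicator A x *\<^sub>R F x) * u x) \<le> norm (B *\<^sub>R (indicator A x *\<^sub>R F x))"
    proof (rule AE_I2)
      fix x
      have "norm (u x) \<le> \<bar>B\<bar>" using B[of x] by linarith
      then have "norm (indicator A x *\<^sub>R F x) * norm (u x) \<le> norm (indicator A x *\<^sub>R F x) * \<bar>B\<bar>"
        by (intro mult_left_mono) auto
      then show "norm ((indicator A x *\<^sub>R F x) * u x) \<le> norm (B *\<^sub>R (indicator A x *\<^sub>R F x))"
        unfolding norm_mult norm_scaleR[of B] by (simp only: mult.commute)
    qed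
  qed
  then show ?thesis by (simp add: set_integrable_def)
qed

text \<open>The part of the window left of 0 is translated by one period; limiting \<open>a\<close>
  to one period makes a single cut suffice. This reconciles coefficients, defined over [-pi, pi],
  with norms, defined over [0, 2 pi].\<close>

lemma periodic_integral_shift:
  fixes F :: "real \<Rightarrow> 'a::{banach, second_countable_topology}"
  assumes per: "periodic2pi F" and int: "set_integrable lborel {0..2*pi} F"
    and a: "- 2 * pi \<le> a" "a \<le> 0"
  shows "set_integrable lborel {a..a + 2 * pi} F"
    and "(LINT t:{a..a + 2 * pi}|lborel. F t) = (LINT t:{0..2*pi}|lborel. F t)"
proof -
  define b where "b = a + 2 * pi"
  have b: "0 \<le> b" "b \<le> 2 * pi" using a by (auto simp: b_def)
  have i1: "set_integrable lborel {0..b} F" and i2: "set_integrable lborel {b..2*pi} F"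
    using b by (auto intro: set_integrable_subset[OF int])
  have sh: "indicator {b..2*pi} (2 * pi + 1 * x) *\<^sub>R F (2 * pi + 1 * x) = indicator {a..0} x *\<^sub>R F x" for x
    using per by (auto simp: indicator_def b_def periodic2pi_def add.commute)
  have i3: "set_integrable lborel {a..0} F"
    using lborel_integrable_real_affine[of "\<lambda>x. indicator {b..2*pi} x *\<^sub>R F x" 1 "2 * pi"] i2
    unfolding set_integrable_def by (simp only: sh)
  have e3: "(LINT t:{a..0}|lborel. F t) = (LINT t:{b..2*pi}|lborel. F t)"
    using lborel_integral_real_affine[of 1 "\<lambda>x. indicator {b..2*pi} x *\<^sub>R F x" "2 * pi"]
    unfolding set_lebesgue_integral_def by (simp only: sh) simp
  have ae: "AE x in lborel. x \<noteq> c" for c :: real by (rule AE_lborel_singleton)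
  have u1: "{a..b} = {a..0} \<union> {0..b}" and u2: "{0..2*pi} = {0..b} \<union> {b..2*pi}"
    using a b by auto
  have "(LINT t:{a..b}|lborel. F t) = (LINT t:{a..0}|lborel. F t) + (LINT t:{0..b}|lborel. F t)"
    unfolding u1 using i1 i3 ae[of 0] by (intro set_integral_Un_AE) auto
  moreover have "(LINT t:{0..2*pi}|lborel. F t) = (LINT t:{0..b}|lborel. F t) + (LINT t:{b..2*pi}|lborel. F t)"
    unfolding u2 using i1 i2 ae[of b] by (intro set_integral_Un_AE) auto
  ultimately show "(LINT t:{a..a + 2 * pi}|lborel. F t) = (LINT t:{0..2*pi}|lborel. F t)"
    using e3 by (simp add: b_def add.commute)
  show "set_integrable lborel {a..a + 2 * pi} F"
    using set_integrable_Un[OF i3 i1] u1 by (simp add: b_def)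
qed

lemma borel_measurable_cis [measurable]: "cis \<in> borel_measurable borel"
  by (intro borel_measurable_continuous_onI continuous_intros)

text \<open>Stated for all \<open>F\<close> with vanishing coefficients at once, so that products of polynomials are
  handled by applying the induction hypotheses one after the other.\<close>
lemma annihilated_times_polynomial:
  assumes "real_polynomial_function p" "set_integrable lborel {0..2*pi} F"
    "\<forall>k::int. (LINT t:{0..2*pi}|lborel. F t * cis (of_int k * t)) = 0"
  shows "set_integrable lborel {0..2*pi} (\<lambda>t. F t * complex_of_real (p (cis t))) \<and>
    (\<forall>k::int. (LINT t:{0..2*pi}|lborel. (F t * complex_of_real (p (cis t))) * cis (of_int k * t)) = 0)"
  using assms
proof (induction p arbitrary: F rule: real_polynomial_function.induct)
  case (linear p)
  \<comment> \<open>On the unit circle a real-linear functional is a trigonometric polynomial of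
    degree 1, so multiplying by it only shifts the Fourier index by 1 in either direction.\<close>
  define a where "a = complex_of_real (p 1) / 2 + complex_of_real (p \<i>) / (2 * \<i>)"
  define b where "b = complex_of_real (p 1) / 2 - complex_of_real (p \<i>) / (2 * \<i>)"
  have p: "complex_of_real (p (cis t)) = a * cis t + b * cis (- t)" for t
  proof -
    have "cis t = cos t *\<^sub>R 1 + sin t *\<^sub>R \<i>" by (simp add: complex_eq_iff)
    then have "p (cis t) = cos t * p 1 + sin t * p \<i>"
      using linear(1) by (simp add: linear_simps)
    then show ?thesis by (simp add: a_def b_def complex_eq_iff)
  qed
  have ic: "set_integrable lborel {0..2*pi} (\<lambda>t. F t * cis (of_int k * t))" for k :: int
    by (rule set_integrable_mult_bounded[OF linear(2), of _ 1]) auto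
  have e: "(F t * complex_of_real (p (cis t))) * cis (of_int k * t)
    = a * (F t * cis (of_int (k + 1) * t)) + b * (F t * cis (of_int (k - 1) * t))" for k t
  proof -
    have "cis (of_int (k + 1) * t) = cis t * cis (of_int k * t)"
      and "cis (of_int (k - 1) * t) = cis (- t) * cis (of_int k * t)"
      unfolding cis_mult by (simp_all add: algebra_simps)
    then show ?thesis unfolding p by (simp only: ring_distribs mult_ac)
  qed
  have "set_integrable lborel {0..2*pi} (\<lambda>t. (F t * complex_of_real (p (cis t))) * cis (of_int 0 * t))"
    unfolding e by (intro set_integral_add set_integrable_mult_right ic)
  moreover have "(LINT t:{0..2*pi}|lborel. (F t * complex_of_real (p (cis t))) * cis (of_int k * t)) = 0" for k
  proof -
    have "(LINT t:{0..2*pi}|lborel. (F t * complex_of_real (p (cis t))) * cis (of_int k * t))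
      = a * (LINT t:{0..2*pi}|lborel. F t * cis (of_int (k + 1) * t))
        + b * (LINT t:{0..2*pi}|lborel. F t * cis (of_int (k - 1) * t))"
      unfolding e by (subst set_integral_add(2)) (intro set_integrable_mult_right ic, intro set_integrable_mult_right ic, simp only: set_integral_mult_right)
    then show ?thesis by (simp only: linear(3)[rule_format]) simp
  qed
  ultimately show ?case by simp
next
  case (const c)
  then show ?case by (simp add: mult.commute[of _ "complex_of_real c"] mult.assoc)
next
  case (add f g)
  have "set_integrable lborel {0..2*pi} (\<lambda>t. (F t * complex_of_real (h (cis t))) * cis (of_int k * t))"
    if "set_integrable lborel {0..2*pi} (\<lambda>t. F t * complex_of_real (h (cis t)))" for h and k :: int
    by (rule set_integrable_mult_bounded[OF that, of _ 1]) auto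
  then show ?case using add(3)[OF add(5,6)] add(4)[OF add(5,6)]
    by (auto simp: distrib_left distrib_right intro!: set_integral_add)
next
  case (mult f g)
  note f = mult(3)[OF mult(5,6)]
  show ?case using mult(4)[OF f[THEN conjunct1] f[THEN conjunct2]] by (simp add: mult.assoc)
qed

text \<open>Stone-Weierstrass on the unit circle replaces \<open>u\<close> by a real polynomial,
  against which \<open>F\<close> integrates to 0; the error is at most \<open>e\<close> times the
  integral of |F|.\<close>

lemma annihilated_times_continuous:
  assumes F: "set_integrable lborel {0..2*pi} F"
    and coef: "\<And>k::int. (LINT t:{0..2*pi}|lborel. F t * cis (of_int k * t)) = 0"
    and u: "continuous_on UNIV u"
  shows "(LINT t:{0..2*pi}|lborel. F t * complex_of_real (u (cis t))) = 0"
proof -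
  define I where "I = (LINT t:{0..2*pi}|lborel. norm (F t))"
  have I: "0 \<le> I" unfolding I_def set_lebesgue_integral_def by (intro integral_nonneg_AE) auto
  have iu: "set_integrable lborel {0..2*pi} (\<lambda>t. F t * complex_of_real (v (cis t)))"
    if v: "continuous_on UNIV v" for v
  proof -
    have "compact (v ` sphere 0 1)"
      by (intro compact_continuous_image continuous_on_subset[OF v]) auto
    then obtain B where B: "\<And>z. z \<in> sphere 0 1 \<Longrightarrow> \<bar>v z\<bar> \<le> B"
      using compact_imp_bounded bounded_iff by (metis imageI real_norm_def)
    have "continuous_on UNIV (\<lambda>t. complex_of_real (v (cis t)))"
      by (intro continuous_intros continuous_on_compose2[OF v]) auto
    then show ?thesis
      by (intro set_integrable_mult_bounded[OF F, of _ B] borel_measurable_continuous_onI) (auto intro: B)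
  qed
  have le: "norm (LINT t:{0..2*pi}|lborel. F t * complex_of_real (u (cis t))) \<le> e * I" if e: "0 < e" for e
  proof -
    obtain p where p: "real_polynomial_function p" "\<And>z. z \<in> sphere 0 1 \<Longrightarrow> \<bar>u z - p z\<bar> < e"
      using Stone_Weierstrass_real_polynomial_function[of "sphere (0::complex) 1" u e]
        continuous_on_subset[OF u] e by auto
    have pc: "continuous_on UNIV p"
      using p(1) by (simp add: continuous_on_polymonial_function real_polynomial_function_eq)
    have p0: "(LINT t:{0..2*pi}|lborel. F t * complex_of_real (p (cis t))) = 0"
      using annihilated_times_polynomial[OF p(1) F, THEN conjunct2, rule_format, of 0] coef by simp
    have "(LINT t:{0..2*pi}|lborel. F t * complex_of_real (u (cis t)))
      = (LINT t:{0..2*pi}|lborel. F t * complex_of_real (u (cis t)) - F t * complex_of_real (p (cis t)))"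
      using iu[OF u] iu[OF pc] p0 by (simp add: set_integral_diff)
    also have "norm \<dots> \<le> (LINT t:{0..2*pi}|lborel. norm (F t * complex_of_real (u (cis t)) - F t * complex_of_real (p (cis t))))"
      unfolding set_lebesgue_integral_def
      by (rule order_trans[OF integral_norm_bound]) simp
    also have "\<dots> \<le> (LINT t:{0..2*pi}|lborel. e * norm (F t))"
    proof (rule set_integral_mono)
      show "set_integrable lborel {0..2*pi} (\<lambda>t. norm (F t * complex_of_real (u (cis t)) - F t * complex_of_real (p (cis t))))"
        by (intro set_integrable_norm set_integral_diff iu u pc)
      show "set_integrable lborel {0..2*pi} (\<lambda>t. e * norm (F t))"
        by (intro set_integrable_mult_right set_integrable_norm F)
      fix t assume "t \<in> {0..2*pi}"
      have "norm (F t * complex_of_real (u (cis t)) - F t * complex_of_real (p (cis t)))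
        = norm (F t) * \<bar>u (cis t) - p (cis t)\<bar>"
        by (metis norm_mult norm_of_real of_real_diff right_diff_distrib')
      also have "\<dots> \<le> norm (F t) * e"
        using p(2)[of "cis t"] by (intro mult_left_mono) auto
      finally show "norm (F t * complex_of_real (u (cis t)) - F t * complex_of_real (p (cis t))) \<le> e * norm (F t)"
        by (simp add: mult.commute)
    qed
    finally show ?thesis by (simp add: I_def)
  qed
  have "norm (LINT t:{0..2*pi}|lborel. F t * complex_of_real (u (cis t))) \<le> 0"
  proof (rule field_le_epsilon)
    fix e :: real assume e: "0 < e"
    \<comment> \<open>\<open>I + 1\<close> instead of \<open>I\<close>, since \<open>I\<close> may
      be 0.\<close>
    have "e / (I + 1) * I \<le> e" using e I by (simp add: field_simps)
    then show "norm (LINT t:{0..2*pi}|lborel. F t * complex_of_real (u (cis t))) \<le> 0 + e"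
      using le[of "e / (I + 1)"] e I by auto
  qed
  then show ?thesis by simp
qed

text \<open>Within one half-open period two arguments with the same \<open>cis\<close> differ by a
  multiple of 2 pi that is less than 2 pi in modulus, hence by 0. So an initial segment corresponds
  to a closed arc of the circle.\<close>

lemma cis_mem_arc_iff:
  assumes "0 \<le> x" "x < 2 * pi" "0 \<le> t" "t < 2 * pi"
  shows "cis t \<in> cis ` {0..x} \<longleftrightarrow> t \<le> x"
proof
  assume "cis t \<in> cis ` {0..x}"
  then obtain s where s: "0 \<le> s" "s \<le> x" "cis t = cis s" by auto
  then have "cos t = cos s" "sin t = sin s" by (auto simp: complex_eq_iff)
  then obtain n :: int where "t = s + 2 * pi * of_int n"
    using sin_cos_eq_iff by metis
  moreover from this have "n = 0"
  proof -
    have "\<bar>2 * pi * of_int n\<bar> < 2 * pi * 1" using assms s calculation by auto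
    then have "\<bar>real_of_int n\<bar> < 1" by (simp add: abs_mult)
    then show ?thesis by linarith
  qed
  ultimately show "t \<le> x" using s by simp
qed (use assms in auto)

text \<open>The indicator of a closed arc is the pointwise limit of the continuous functions
  \<open>u n\<close>, which decrease linearly with the distance to the arc; dominated convergence
  does the rest.\<close>

lemma annihilated_initial_segment:
  assumes F: "set_integrable lborel {0..2*pi} F"
    and coef: "\<And>k::int. (LINT t:{0..2*pi}|lborel. F t * cis (of_int k * t)) = 0"
    and x: "0 \<le> x" "x < 2 * pi"
  shows "(LINT t:{0..2*pi}|lborel. F t * indicator {..x} t) = 0"
proof -
  define C where "C = cis ` {0..x}"
  define u where "u n z = max 0 (1 - real n * infdist z C)" for n z
  have C: "closed C" "C \<noteq> {}"
    using x by (auto simp: C_def intro!: compact_imp_closed compact_continuous_image continuous_intros)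
  have "continuous_on UNIV (u n)" for n unfolding u_def by (intro continuous_intros)
  then have z: "(LINT t:{0..2*pi}|lborel. F t * complex_of_real (u n (cis t))) = 0" for n
    by (intro annihilated_times_continuous[OF F coef])
  have i: "integrable lborel (\<lambda>t. indicator {0..2*pi} t *\<^sub>R F t)" using F by (simp add: set_integrable_def)
  note [measurable] = borel_measurable_integrable[OF i]
  have [measurable]: "(\<lambda>t. complex_of_real (u n (cis t))) \<in> borel_measurable borel" for n
    unfolding u_def by (intro borel_measurable_continuous_onI continuous_intros)
  have m1: "(\<lambda>t. (indicator {0..2*pi} t *\<^sub>R F t) * complex_of_real (u n (cis t))) \<in> borel_measurable lborel" for n
    by measurable
  have m2: "(\<lambda>t. (indicator {0..2*pi} t *\<^sub>R F t) * indicator {..x} t) \<in> borel_measurable lborel"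
    by measurable
  have "(\<lambda>n. LINT t:{0..2*pi}|lborel. F t * complex_of_real (u n (cis t)))
    \<longlonglongrightarrow> (LINT t:{0..2*pi}|lborel. F t * indicator {..x} t)"
    unfolding set_lebesgue_integral_def
  proof (rule integral_dominated_convergence[where w="\<lambda>t. norm (indicator {0..2*pi} t *\<^sub>R F t)"])
    show "integrable lborel (\<lambda>t. norm (indicator {0..2*pi} t *\<^sub>R F t))" by (rule integrable_norm[OF i])
    show "AE t in lborel. norm (indicator {0..2*pi} t *\<^sub>R (F t * complex_of_real (u n (cis t))))
      \<le> norm (indicator {0..2*pi} t *\<^sub>R F t)" for n
    proof (rule AE_I2)
      fix t
      have "0 \<le> u n (cis t)" "u n (cis t) \<le> 1" by (auto simp: u_def infdist_nonneg)
      then show "norm (indicator {0..2*pi} t *\<^sub>R (F t * complex_of_real (u n (cis t))))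
        \<le> norm (indicator {0..2*pi} t *\<^sub>R F t)"
        by (auto simp: norm_mult indicator_def mult_left_le)
    qed
    \<comment> \<open>At \<open>2 * pi\<close> the convergence can fail: \<open>cis\<close> returns
      to the arc there, while the indicator of {..x} is 0.\<close>
    have "AE t in lborel. t \<noteq> 2 * pi" by (rule AE_lborel_singleton)
    then show "AE t in lborel. (\<lambda>n. indicator {0..2*pi} t *\<^sub>R (F t * complex_of_real (u n (cis t))))
      \<longlonglongrightarrow> indicator {0..2*pi} t *\<^sub>R (F t * indicator {..x} t)"
    proof eventually_elim
      case (elim t)
      show ?case
      proof (cases "t \<in> {0..2*pi}")
        case True
        then have t: "0 \<le> t" "t < 2 * pi" using elim by auto
        have "(\<lambda>n. u n (cis t)) \<longlonglongrightarrow> indicator {..x} t"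
        proof (cases "t \<le> x")
          case le: True
          then have "cis t \<in> C" using cis_mem_arc_iff[OF x t] by (simp add: C_def)
          then have "u n (cis t) = 1" for n by (simp add: u_def)
          then show ?thesis using le by simp
        next
          case gt: False
          then have "cis t \<notin> C" using cis_mem_arc_iff[OF x t] by (simp add: C_def)
          then have pos: "0 < infdist (cis t) C"
            using C in_closed_iff_infdist_zero[OF C, of "cis t"] infdist_nonneg[of "cis t" C] by linarith
          obtain N where "1 < real N * infdist (cis t) C" using reals_Archimedean3[OF pos] by blast
          then have "u n (cis t) = 0" if "N \<le> n" for n
            using mult_right_mono[of "real N" "real n" "infdist (cis t) C"] that pos
            unfolding u_def by (intro max_absorb1) linarith
          then have "eventually (\<lambda>n. u n (cis t) = 0) sequentially"
            by (auto simp: eventually_sequentially)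
          then show ?thesis using gt by (simp add: tendsto_eventually)
        qed
        then have "(\<lambda>n. complex_of_real (u n (cis t))) \<longlonglongrightarrow> complex_of_real (indicator {..x} t)"
          by (rule tendsto_of_real)
        then have "(\<lambda>n. F t * complex_of_real (u n (cis t))) \<longlonglongrightarrow> F t * indicator {..x} t"
          by (intro tendsto_mult tendsto_const) (cases "t \<le> x"; simp)
        then show ?thesis using True by simp
      qed simp
    qed
  qed (use m1 m2 in simp_all)
  then show ?thesis unfolding z by (simp add: LIMSEQ_const_iff)
qed

text \<open>All integrals over half-lines vanish, so the positive and negative parts are densities
  of measures that agree on every {x<..}. These measures are equal, hence so are the densities
  almost everywhere.\<close>

lemma annihilated_AE_zero:
  fixes F :: "real \<Rightarrow> real"
  assumes F: "set_integrable lborel {0..2*pi} F"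
    and coef: "\<And>k::int. (LINT t:{0..2*pi}|lborel. complex_of_real (F t) * cis (of_int k * t)) = 0"
  shows "AE t in lborel. t \<in> {0..2*pi} \<longrightarrow> F t = 0"
proof -
  define G where "G t = indicator {0..2*pi} t *\<^sub>R F t" for t
  have G: "integrable lborel G" using F unfolding G_def[abs_def] set_integrable_def .
  note [measurable] = borel_measurable_integrable[OF G]
  have FC: "set_integrable lborel {0..2*pi} (\<lambda>t. complex_of_real (F t))"
    using integrable_of_real[OF G, where 'a=complex]
    by (simp add: set_integrable_def G_def scaleR_conv_of_real)
  have tot: "(LINT t|lborel. G t) = 0"
  proof -
    have "complex_of_real (LINT t|lborel. G t) = 0"
      using coef[of 0] by (simp add: G_def set_lebesgue_integral_def scaleR_conv_of_real flip: of_real_mult)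
    then show ?thesis by simp
  qed
  have Gi: "integrable lborel (\<lambda>t. G t * indicator {x<..} t)" for x
    using integrable_mult_indicator[OF _ G, of "{x<..}"] by (simp add: mult.commute)
  have upper: "(LINT t|lborel. G t * indicator {x<..} t) = 0" for x
  proof -
    \<comment> \<open>Outside the period, the half-line either contains the whole support up to
      nothing lost, where the coefficient at 0 gives the claim, or misses all but a region where the
      product is 0.\<close>
    consider "x < 0" | "0 \<le> x" "x < 2 * pi" | "2 * pi \<le> x" by linarith
    then show ?thesis
    proof cases
      case 1
      then have "G t * indicator {x<..} t = G t" for t by (auto simp: G_def indicator_def)
      then show ?thesis using tot by (simp only:)
    next
      case 3
      then have "G t * indicator {x<..} t = 0" for t by (auto simp: G_def indicator_def)
      then show ?thesis by (simp only: integral_zero)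
    next
      case 2
      have "complex_of_real (LINT t|lborel. G t * indicator {..x} t)
        = (LINT t:{0..2*pi}|lborel. complex_of_real (F t) * indicator {..x} t)"
        unfolding set_lebesgue_integral_def G_def integral_complex_of_real[symmetric]
        by (intro Bochner_Integration.integral_cong) (auto simp: indicator_def)
      also have "\<dots> = 0" by (rule annihilated_initial_segment[OF FC coef 2])
      finally have low: "(LINT t|lborel. G t * indicator {..x} t) = 0" by simp
      have "(LINT t|lborel. G t) = (LINT t|lborel. G t * indicator {..x} t + G t * indicator {x<..} t)"
        by (intro Bochner_Integration.integral_cong) (auto simp: indicator_def)
      also have "\<dots> = (LINT t|lborel. G t * indicator {..x} t) + (LINT t|lborel. G t * indicator {x<..} t)"
        using integrable_mult_indicator[OF _ G, of "{..x}"] Gi[of x]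
        by (intro Bochner_Integration.integral_add) (auto simp: mult.commute)
      finally show ?thesis using tot low by simp
    qed
  qed
  define P where "P t = max 0 (G t)" for t
  define N where "N t = max 0 (- G t)" for t
  have PN: "integrable lborel P" "integrable lborel N" unfolding P_def N_def using G by auto
  note [measurable] = borel_measurable_integrable[OF PN(1)] borel_measurable_integrable[OF PN(2)]
  have em: "emeasure (density lborel (\<lambda>t. ennreal (Q t))) {x<..} = ennreal (LINT t|lborel. Q t * indicator {x<..} t)"
    if Q: "integrable lborel Q" "\<And>t. 0 \<le> Q t" for Q and x :: real
  proof -
    note [measurable] = borel_measurable_integrable[OF Q(1)]
    have "emeasure (density lborel (\<lambda>t. ennreal (Q t))) {x<..} = (\<integral>\<^sup>+t. ennreal (Q t) * indicator {x<..} t \<partial>lborel)"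
      by (subst emeasure_density) auto
    also have "\<dots> = (\<integral>\<^sup>+t. ennreal (Q t * indicator {x<..} t) \<partial>lborel)"
      by (intro nn_integral_cong) (auto simp: indicator_def)
    also have "\<dots> = ennreal (LINT t|lborel. Q t * indicator {x<..} t)"
      using integrable_mult_indicator[OF _ Q(1), of "{x<..}"] Q(2)
      by (intro nn_integral_eq_integral) (auto simp: mult.commute)
    finally show ?thesis .
  qed
  have eq: "(LINT t|lborel. P t * indicator {x<..} t) = (LINT t|lborel. N t * indicator {x<..} t)" for x
  proof -
    have "(LINT t|lborel. G t * indicator {x<..} t) = (LINT t|lborel. P t * indicator {x<..} t - N t * indicator {x<..} t)"
      by (intro Bochner_Integration.integral_cong) (auto simp: P_def N_def indicator_def)
    also have "\<dots> = (LINT t|lborel. P t * indicator {x<..} t) - (LINT t|lborel. N t * indicator {x<..} t)"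
      using integrable_mult_indicator[OF _ PN(1), of "{x<..}"] integrable_mult_indicator[OF _ PN(2), of "{x<..}"]
      by (intro Bochner_Integration.integral_diff) (auto simp: mult.commute)
    finally show ?thesis using upper[of x] by simp
  qed
  have nn: "0 \<le> P t" "0 \<le> N t" for t by (auto simp: P_def N_def)
  have "density lborel (\<lambda>t. ennreal (P t)) = density lborel (\<lambda>t. ennreal (N t))"
    by (rule measure_eqI_lessThan) (simp_all add: em[OF PN(1) nn(1)] em[OF PN(2) nn(2)] eq)
  then have "AE t in lborel. ennreal (P t) = ennreal (N t)"
    by (intro sigma_finite_measure.density_unique[OF sigma_finite_lborel]) auto
  then show ?thesis
  proof eventually_elim
    case (elim t)
    then have "G t = 0" using nn[of t] by (auto simp: P_def N_def max_def split: if_splits)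
    then show ?case by (auto simp: G_def)
  qed
qed

section \<open>Fourier coefficients and series\<close>

lemma set_integral_Re:
  fixes F :: "real \<Rightarrow> complex"
  assumes "set_integrable lborel A F"
  shows "Re (LINT t:A|lborel. F t) = (LINT t:A|lborel. Re (F t))"
  using integral_Re[of lborel "\<lambda>t. indicator A t *\<^sub>R F t"] assms
  by (simp add: set_integrable_def set_lebesgue_integral_def)

lemma set_integral_sum:
  fixes F :: "'i \<Rightarrow> real \<Rightarrow> 'a::{banach, second_countable_topology}"
  assumes "\<And>i. i \<in> I \<Longrightarrow> set_integrable lborel A (F i)"
  shows "set_integrable lborel A (\<lambda>t. \<Sum>i\<in>I. F i t)"
    and "(LINT t:A|lborel. \<Sum>i\<in>I. F i t) = (\<Sum>i\<in>I. LINT t:A|lborel. F i t)"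
  using assms
  by (auto simp: set_integrable_def set_lebesgue_integral_def scaleR_sum_right
      intro!: Bochner_Integration.integrable_sum Bochner_Integration.integral_sum)

lemma in_Lp_1_integrable:
  assumes "in_Lp 1 f"
  shows "set_integrable lborel {0..2*pi} f"
  using assms unfolding in_Lp_def
  by (auto intro!: set_integrable_bound[where f="\<lambda>x. \<bar>f x\<bar> powr 1" and g=f] simp: set_borel_measurable_def)

lemma in_Lp_1_integrable_cis:
  assumes "in_Lp 1 f"
  shows "set_integrable lborel {0..2*pi} (\<lambda>t. complex_of_real (f t) * cis (a * t + b))"
proof (rule set_integrable_mult_bounded[where B=1])
  show "set_integrable lborel {0..2*pi} (\<lambda>t. complex_of_real (f t))"
    using integrable_of_real[OF in_Lp_1_integrable[OF assms, unfolded set_integrable_def], where 'a=complex]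
    by (simp add: set_integrable_def scaleR_conv_of_real)
qed auto

lemma in_Lp_continuous:
  assumes "periodic2pi f" "continuous_on UNIV f" "0 < p"
  shows "in_Lp p f"
  unfolding in_Lp_def
proof (intro conjI)
  show "set_integrable lborel {0..2 * pi} (\<lambda>x. \<bar>f x\<bar> powr p)"
    using assms by (intro borel_integrable_atLeastAtMost' continuous_on_powr' continuous_on_const
        continuous_on_rabs continuous_on_subset[OF assms(2)]) auto
qed (use assms borel_measurable_continuous_onI in auto)

lemma cis_int_periodic: "cis (of_int k * (t + 2 * pi)) = cis (of_int k * t)" for k :: int
proof -
  have "cis (of_int k * (t + 2 * pi)) = cis (of_int k * t) * cis (2 * pi * of_int k)"
    unfolding cis_mult by (simp add: algebra_simps)
  then show ?thesis by simp
qed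

lemma cos_nat_periodic: "cos (real k * (t + 2 * pi) + a) = cos (real k * t + a)"
proof -
  have "cis (real k * (t + 2 * pi) + a) = cis (real k * t + a)"
    using cis_int_periodic[of "int k" t] by (simp flip: cis_mult)
  then show ?thesis by (simp add: complex_eq_iff)
qed

lemma fcoef_eq:
  assumes "in_Lp 1 f"
  shows "fcoef f k = complex_of_real (1 / (2 * pi)) *
    (LINT t:{0..2*pi}|lborel. complex_of_real (f t) * cis (- (of_int k * t)))"
proof -
  have "periodic2pi (\<lambda>t. complex_of_real (f t) * cis (- (of_int k * t)))"
    using assms cis_int_periodic[of "- k"] by (simp add: periodic2pi_def in_Lp_def)
  moreover have "set_integrable lborel {0..2*pi} (\<lambda>t. complex_of_real (f t) * cis (- (of_int k * t)))"
    using in_Lp_1_integrable_cis[OF assms, of "- of_int k" 0] by simp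
  ultimately show ?thesis
    using periodic_integral_shift(2)[of "\<lambda>t. complex_of_real (f t) * cis (- (of_int k * t))" "- pi"]
    by (simp add: fcoef_def)
qed

lemma fcoef_uminus: "fcoef f (- k) = cnj (fcoef f k)"
proof -
  have "(LINT t:{-pi..pi}|lborel. complex_of_real (f t) * cis (- (of_int (- k) * t)))
    = (LINT t:{-pi..pi}|lborel. cnj (complex_of_real (f t) * cis (- (of_int k * t))))"
    by (simp add: cis_cnj)
  also have "\<dots> = cnj (LINT t:{-pi..pi}|lborel. complex_of_real (f t) * cis (- (of_int k * t)))"
    unfolding set_lebesgue_integral_def complex_cnj_scaleR[symmetric] by (rule Bochner_Integration.integral_cnj)
  finally show ?thesis unfolding fcoef_def complex_cnj_mult complex_cnj_complex_of_real by simp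
qed

lemma cmod_fcoef_le:
  assumes "in_Lp 1 f"
  shows "cmod (fcoef f k) \<le> 1 / (2 * pi) * (LINT t:{0..2*pi}|lborel. \<bar>f t\<bar>)"
proof -
  have "cmod (LINT t:{0..2*pi}|lborel. complex_of_real (f t) * cis (- (of_int k * t)))
    \<le> (LINT t:{0..2*pi}|lborel. \<bar>f t\<bar>)"
    unfolding set_lebesgue_integral_def
    by (rule order_trans[OF integral_norm_bound]) (simp add: norm_mult)
  then show ?thesis unfolding fcoef_eq[OF assms] by (simp add: norm_mult norm_divide divide_right_mono)
qed

lemma integral_cis_int:
  "(LINT t:{0..2*pi}|lborel. cis (of_int j * t)) = (if j = 0 then complex_of_real (2 * pi) else 0)" for j :: int
proof (cases "j = 0")
  case True
  then show ?thesis by (simp add: set_integral_const scaleR_conv_of_real)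
next
  case False
  define G where "G t = cis (of_int j * t) / (\<i> * of_int j)" for t
  have "(LINT t:{0..2*pi}|lborel. cis (of_int j * t)) = G (2 * pi) - G 0"
    unfolding set_lebesgue_integral_def
  proof (rule integral_FTC_atLeastAtMost)
    fix t :: real
    have "((\<lambda>t. cis (of_int j * t)) has_vector_derivative of_int j *\<^sub>R (\<i> * cis (of_int j * t))) (at t within {0..2*pi})"
      unfolding has_vector_derivative_def
      by (auto intro!: derivative_eq_intros simp: fun_eq_iff scaleR_conv_of_real)
    then have "(G has_vector_derivative (of_int j *\<^sub>R (\<i> * cis (of_int j * t))) / (\<i> * of_int j)) (at t within {0..2*pi})"
      unfolding G_def by (rule has_vector_derivative_divide)
    then show "(G has_vector_derivative cis (of_int j * t)) (at t within {0..2*pi})"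
      using False by (simp add: scaleR_conv_of_real)
  qed (auto intro!: continuous_intros)
  also have "G (2 * pi) = G 0" using cis_int_periodic[of j 0] by (simp add: G_def)
  finally show ?thesis using False by simp
qed

lemma integrable_cis: "set_integrable lborel {0..2*pi} (\<lambda>t. c * cis (a * t + b))"
  by (intro borel_integrable_atLeastAtMost' continuous_intros)

text \<open>Coefficients of a real function at \<open>k\<close> and \<open>- k\<close> are conjugate
  and combine to twice a real part. The real form suits kernel estimates, the complex one suits the
  index sets of \<open>e_orth_inf\<close>.\<close>

lemma symmetric_partial_sum:
  "complex_of_real (Re (fcoef f 0) + (\<Sum>k=1..m. 2 * Re (fcoef f (int k) * cis (real k * t))))
    = (\<Sum>k\<in>{- int m..int m}. fcoef f k * cis (of_int k * t))"
proof (induction m)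
  case 0
  have "Im (fcoef f 0) = 0" using fcoef_uminus[of f 0] by (simp add: complex_eq_iff)
  then show ?case by (simp add: complex_eq_iff)
next
  case (Suc m)
  have "{- int (Suc m)..int (Suc m)} = insert (int (Suc m)) (insert (- int (Suc m)) {- int m..int m})"
    by auto
  then have "(\<Sum>k\<in>{- int (Suc m)..int (Suc m)}. fcoef f k * cis (of_int k * t))
    = fcoef f (int (Suc m)) * cis (real (Suc m) * t) + fcoef f (- int (Suc m)) * cis (- (real (Suc m) * t))
      + (\<Sum>k\<in>{- int m..int m}. fcoef f k * cis (of_int k * t))"
    by (simp add: add_ac del: of_nat_Suc)
  also have "fcoef f (- int (Suc m)) * cis (- (real (Suc m) * t)) = cnj (fcoef f (int (Suc m)) * cis (real (Suc m) * t))"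
    unfolding fcoef_uminus by (simp add: cis_cnj)
  also have "fcoef f (int (Suc m)) * cis (real (Suc m) * t) + cnj (fcoef f (int (Suc m)) * cis (real (Suc m) * t))
    = complex_of_real (2 * Re (fcoef f (int (Suc m)) * cis (real (Suc m) * t)))"
    by (rule complex_add_cnj)
  finally show ?case unfolding Suc.IH[symmetric] by (simp add: add_ac)
qed

text \<open>The series converges to some bounded \<open>g\<close> by the majorant \<open>b\<close>.
  Dominated convergence shows that \<open>g\<close> has the coefficients of \<open>f\<close>, and
  uniqueness identifies the two almost everywhere.\<close>

lemma fourier_series_converges_AE:
  assumes f: "in_Lp 1 f" and b: "summable b" "\<And>k. 1 \<le> k \<Longrightarrow> cmod (fcoef f (int k)) \<le> b k"
  shows "AE t in lborel. t \<in> {0..2*pi} \<longrightarrow>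
    (\<lambda>m. Re (fcoef f 0) + (\<Sum>k=1..m. 2 * Re (fcoef f (int k) * cis (real k * t)))) \<longlonglongrightarrow> f t"
proof -
  define G where "G t k = 2 * Re (fcoef f (int (Suc k)) * cis (real (Suc k) * t))" for t and k :: nat
  define S where "S m t = Re (fcoef f 0) + (\<Sum>k=1..m. 2 * Re (fcoef f (int k) * cis (real k * t)))" for m t
  have SG: "S m t = Re (fcoef f 0) + (\<Sum>k<m. G t k)" for m t
    unfolding S_def G_def by (simp only: One_nat_def sum.atLeast1_atMost_eq)
  have Gb: "norm (G t k) \<le> 2 * b (Suc k)" for t k
  proof -
    have "\<bar>Re (fcoef f (int (Suc k)) * cis (real (Suc k) * t))\<bar> \<le> cmod (fcoef f (int (Suc k)))"
      by (rule order_trans[OF abs_Re_le_cmod]) (simp add: norm_mult)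
    then show ?thesis using b(2)[of "Suc k"] by (simp add: G_def abs_mult)
  qed
  have sb: "summable (\<lambda>k. 2 * b (Suc k))"
    using b(1) by (intro summable_mult) (simp add: summable_Suc_iff)
  have bpos: "0 \<le> b (Suc k)" for k using order_trans[OF norm_ge_zero b(2)[of "Suc k"]] by simp
  have sG: "summable (G t)" for t by (rule summable_comparison_test'[OF sb, of 0]) (rule Gb)
  define g where "g t = Re (fcoef f 0) + suminf (G t)" for t
  define B where "B = \<bar>Re (fcoef f 0)\<bar> + (\<Sum>k. 2 * b (Suc k))"
  have lim: "(\<lambda>m. S m t) \<longlonglongrightarrow> g t" for t
    unfolding SG g_def by (intro tendsto_intros summable_LIMSEQ sG)
  have SB: "\<bar>S m t\<bar> \<le> B" for m t
  proof -
    have "\<bar>\<Sum>k<m. G t k\<bar> \<le> (\<Sum>k<m. 2 * b (Suc k))"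
      using Gb by (intro order_trans[OF sum_abs] sum_mono) auto
    also have "\<dots> \<le> (\<Sum>k. 2 * b (Suc k))" using sb bpos by (intro sum_le_suminf) auto
    finally show ?thesis unfolding SG B_def by linarith
  qed
  have Sm [measurable]: "S m \<in> borel_measurable borel" for m
    unfolding S_def by (intro borel_measurable_continuous_onI continuous_intros)
  have gm [measurable]: "g \<in> borel_measurable borel"
    by (rule borel_measurable_LIMSEQ_real[OF lim Sm])
  have gB: "\<bar>g t\<bar> \<le> B" for t
    by (rule tendsto_upperbound[OF tendsto_rabs[OF lim]]) (use SB in auto)
  have gi: "set_integrable lborel {0..2*pi} (\<lambda>t. complex_of_real (g t) * cis (of_int j * t))" for j :: int
    using set_integrable_mult_bounded[OF integrable_cis[of 1 "of_int j" 0], of "\<lambda>t. complex_of_real (g t)" B] gB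
    by (simp add: mult.commute)
  have gcoef: "(LINT t:{0..2*pi}|lborel. complex_of_real (g t) * cis (of_int j * t)) = complex_of_real (2 * pi) * fcoef f (- j)" for j :: int
  proof -
    have "(\<lambda>m. LINT t:{0..2*pi}|lborel. complex_of_real (S m t) * cis (of_int j * t))
      \<longlonglongrightarrow> (LINT t:{0..2*pi}|lborel. complex_of_real (g t) * cis (of_int j * t))"
      unfolding set_lebesgue_integral_def
    proof (rule integral_dominated_convergence[where w="\<lambda>t. indicator {0..2*pi} t *\<^sub>R B"])
      show "integrable lborel (\<lambda>t. indicator {0..2*pi} t *\<^sub>R B)"
        using borel_integrable_atLeastAtMost'[of 0 "2 * pi" "\<lambda>t. B"] by (simp add: set_integrable_def)
      show "AE t in lborel. (\<lambda>m. indicator {0..2*pi} t *\<^sub>R (complex_of_real (S m t) * cis (of_int j * t)))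
        \<longlonglongrightarrow> indicator {0..2*pi} t *\<^sub>R (complex_of_real (g t) * cis (of_int j * t))"
        by (intro AE_I2 tendsto_intros lim)
      show "AE t in lborel. norm (indicator {0..2*pi} t *\<^sub>R (complex_of_real (S m t) * cis (of_int j * t)))
        \<le> indicator {0..2*pi} t *\<^sub>R B" for m
        using SB by (intro AE_I2) (auto simp: norm_mult indicator_def)
    qed measurable
    \<comment> \<open>By orthogonality these integrals are constant as soon as the partial sum
      contains the frequency \<open>- j\<close>.\<close>
    moreover have "(LINT t:{0..2*pi}|lborel. complex_of_real (S m t) * cis (of_int j * t))
      = complex_of_real (2 * pi) * fcoef f (- j)" if m: "\<bar>j\<bar> \<le> int m" for m
    proof -
      have "complex_of_real (S m t) * cis (of_int j * t)
        = (\<Sum>k\<in>{- int m..int m}. fcoef f k * cis (of_int (k + j) * t))" for t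
        unfolding S_def symmetric_partial_sum sum_distrib_right
        by (intro sum.cong) (simp_all add: cis_mult distrib_right)
      then have "(LINT t:{0..2*pi}|lborel. complex_of_real (S m t) * cis (of_int j * t))
        = (LINT t:{0..2*pi}|lborel. \<Sum>k\<in>{- int m..int m}. fcoef f k * cis (of_int (k + j) * t))"
        by simp
      also have "\<dots> = (\<Sum>k\<in>{- int m..int m}. LINT t:{0..2*pi}|lborel. fcoef f k * cis (of_int (k + j) * t))"
        using integrable_cis[where b=0] by (intro set_integral_sum) simp
      also have "\<dots> = (\<Sum>k\<in>{- int m..int m}. if k = - j then complex_of_real (2 * pi) * fcoef f k else 0)"
        unfolding set_integral_mult_right integral_cis_int by (intro sum.cong) (auto simp: eq_neg_iff_add_eq_0)
      also have "\<dots> = complex_of_real (2 * pi) * fcoef f (- j)"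
        using m by (subst sum.delta) auto
      finally show ?thesis .
    qed
    then have "eventually (\<lambda>m. (LINT t:{0..2*pi}|lborel. complex_of_real (S m t) * cis (of_int j * t))
      = complex_of_real (2 * pi) * fcoef f (- j)) sequentially"
      by (intro eventually_sequentiallyI[of "nat \<bar>j\<bar>"]) auto
    then have "(\<lambda>m. LINT t:{0..2*pi}|lborel. complex_of_real (S m t) * cis (of_int j * t))
      \<longlonglongrightarrow> complex_of_real (2 * pi) * fcoef f (- j)"
      by (rule tendsto_eventually)
    ultimately show ?thesis by (rule LIMSEQ_unique)
  qed
  have "AE t in lborel. t \<in> {0..2*pi} \<longrightarrow> f t - g t = 0"
  proof (rule annihilated_AE_zero)
    have "set_integrable lborel {0..2*pi} (\<lambda>t. 1 * g t)"
      using gB by (intro set_integrable_mult_bounded[of _ _ _ B] borel_integrable_atLeastAtMost') auto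
    then show "set_integrable lborel {0..2*pi} (\<lambda>t. f t - g t)"
      using in_Lp_1_integrable[OF f] by (intro set_integral_diff) auto
    show "(LINT t:{0..2*pi}|lborel. complex_of_real (f t - g t) * cis (of_int k * t)) = 0" for k :: int
    proof -
      have "(LINT t:{0..2*pi}|lborel. complex_of_real (f t - g t) * cis (of_int k * t))
        = (LINT t:{0..2*pi}|lborel. complex_of_real (f t) * cis (of_int k * t) - complex_of_real (g t) * cis (of_int k * t))"
        by (simp add: left_diff_distrib)
      also have "\<dots> = (LINT t:{0..2*pi}|lborel. complex_of_real (f t) * cis (of_int k * t))
        - (LINT t:{0..2*pi}|lborel. complex_of_real (g t) * cis (of_int k * t))"
        using in_Lp_1_integrable_cis[OF f, of "of_int k" 0] gi by (intro set_integral_diff) simp_all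
      also have "(LINT t:{0..2*pi}|lborel. complex_of_real (f t) * cis (of_int k * t)) = complex_of_real (2 * pi) * fcoef f (- k)"
        unfolding fcoef_eq[OF f] by simp
      finally show ?thesis using gcoef[of k] by simp
    qed
  qed
  then show ?thesis
  proof eventually_elim
    case (elim t)
    then show ?case using lim[of t] by (auto simp: S_def)
  qed
qed

section \<open>The upper bound\<close>

text \<open>Pointwise |y| is at most |y|^p + 1; this crude bound suffices to control the Fourier
  coefficients uniformly over the class.\<close>

lemma Lp_ball_integral_abs_le:
  assumes p: "1 < p" and f: "in_Lp p f" "in_Lp 1 f" and n: "(LINT t:{0..2*pi}|lborel. \<bar>f t\<bar> powr p) \<le> 1"
  shows "(LINT t:{0..2*pi}|lborel. \<bar>f t\<bar>) \<le> 1 + 2 * pi"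
proof -
  have i: "set_integrable lborel {0..2*pi} (\<lambda>t. \<bar>f t\<bar> powr p)" using f(1) by (simp add: in_Lp_def)
  have i1: "set_integrable lborel {0..2*pi} (\<lambda>t. 1 :: real)"
    by (intro borel_integrable_atLeastAtMost' continuous_intros)
  have "(LINT t:{0..2*pi}|lborel. \<bar>f t\<bar>) \<le> (LINT t:{0..2*pi}|lborel. \<bar>f t\<bar> powr p + 1)"
  proof (rule set_integral_mono)
    show "\<bar>f t\<bar> \<le> \<bar>f t\<bar> powr p + 1" for t
    proof (cases "\<bar>f t\<bar> \<le> 1")
      case False
      then have "\<bar>f t\<bar> powr 1 \<le> \<bar>f t\<bar> powr p" using p by (intro powr_mono) auto
      then show ?thesis by simp
    qed (simp add: add_increasing)
  qed (use i i1 in_Lp_1_integrable[OF f(2)] in \<open>auto intro!: set_integral_add set_integrable_abs\<close>)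
  also have "\<dots> = (LINT t:{0..2*pi}|lborel. \<bar>f t\<bar> powr p) + (LINT t:{0..2*pi}|lborel. 1)"
    using i i1 by (rule set_integral_add)
  also have "(LINT t:{0..2*pi}|lborel. (1::real)) = 2 * pi" by (simp add: set_integral_const)
  finally show ?thesis using n by simp
qed

lemma periodic_integral_translate:
  fixes g :: "real \<Rightarrow> real"
  assumes "periodic2pi g" "set_integrable lborel {0..2*pi} g" "x \<in> {0..2*pi}"
  shows "(LINT t:{0..2*pi}|lborel. g (t - x)) = (LINT t:{0..2*pi}|lborel. g t)"
proof -
  have "(LINT t:{- x..- x + 2 * pi}|lborel. g t) = (LINT t:{0..2*pi}|lborel. g (t - x))"
    unfolding set_lebesgue_integral_def
    by (subst lborel_integral_real_affine[of 1 _ "- x"])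
      (auto intro!: Bochner_Integration.integral_cong simp: indicator_def)
  then show ?thesis using periodic_integral_shift(2)[OF assms(1,2), of "- x"] assms(3) by simp
qed

text \<open>The relation between the coefficients is solved for \<open>fcoef f k\<close>: it is
  \<open>\<psi> k\<close> times the coefficient of \<open>\<phi>\<close>, rotated by - \<beta> pi /
  2. Written as an integral and summed over \<open>k\<close>, this is a convolution of
  \<open>\<phi>\<close> with a cosine kernel.\<close>

lemma psi_beta_deriv_segment:
  assumes d: "is_psi_beta_deriv \<psi> \<beta> f \<phi>" and f: "in_Lp 1 f"
    and pos: "\<And>k. 1 \<le> k \<Longrightarrow> 0 < \<psi> (real k)" and n: "1 \<le> n"
  shows "(\<Sum>k=n..m. 2 * Re (fcoef f (int k) * cis (real k * x)))
    = 1 / pi * (LINT t:{0..2*pi}|lborel. \<phi> t * (\<Sum>k=n..m. \<psi> (real k) * cos (real k * (t - x) + \<beta> * pi / 2)))"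
proof -
  have \<phi>: "in_Lp 1 \<phi>" using d by (simp add: is_psi_beta_deriv_def)
  have one: "2 * Re (fcoef f (int k) * cis (real k * x))
    = (LINT t:{0..2*pi}|lborel. 1 / pi * (\<phi> t * (\<psi> (real k) * cos (real k * (t - x) + \<beta> * pi / 2))))"
    if k: "1 \<le> k" for k
  proof -
    have "fcoef \<phi> (int k) = fcoef f (int k) / complex_of_real (\<psi> (real k)) * cis (\<beta> * pi / 2)"
      using d k by (simp add: is_psi_beta_deriv_def)
    then have "fcoef \<phi> (int k) * cis (- (\<beta> * pi / 2)) = fcoef f (int k) / complex_of_real (\<psi> (real k))"
      by (simp add: cis_mult mult.assoc)
    then have "fcoef f (int k) = complex_of_real (\<psi> (real k)) * (fcoef \<phi> (int k) * cis (- (\<beta> * pi / 2)))"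
      using pos[OF k] by simp
    then have "2 * Re (fcoef f (int k) * cis (real k * x))
      = 2 * Re (complex_of_real (\<psi> (real k)) * (fcoef \<phi> (int k) * cis (- (\<beta> * pi / 2))) * cis (real k * x))"
      by simp
    also have "complex_of_real (\<psi> (real k)) * (fcoef \<phi> (int k) * cis (- (\<beta> * pi / 2))) * cis (real k * x)
      = (LINT t:{0..2*pi}|lborel. complex_of_real (\<psi> (real k) / (2 * pi)) *
          (complex_of_real (\<phi> t) * cis (- real k * t + (real k * x - \<beta> * pi / 2))))"
    proof -
      have "cis (- real k * t + (real k * x - \<beta> * pi / 2))
        = cis (- (of_int (int k) * t)) * (cis (- (\<beta> * pi / 2)) * cis (real k * x))" for t
        unfolding cis_mult by (simp add: algebra_simps)
      then have e: "complex_of_real (\<psi> (real k) / (2 * pi)) *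
          (complex_of_real (\<phi> t) * cis (- real k * t + (real k * x - \<beta> * pi / 2)))
        = (complex_of_real (\<psi> (real k) / (2 * pi)) * (cis (- (\<beta> * pi / 2)) * cis (real k * x))) *
          (complex_of_real (\<phi> t) * cis (- (of_int (int k) * t)))" for t
        by (simp only: mult_ac)
      show ?thesis unfolding e set_integral_mult_right fcoef_eq[OF \<phi>] by simp
    qed
    also have "2 * Re \<dots> = 2 * (LINT t:{0..2*pi}|lborel. Re (complex_of_real (\<psi> (real k) / (2 * pi)) *
          (complex_of_real (\<phi> t) * cis (- real k * t + (real k * x - \<beta> * pi / 2)))))"
      by (subst set_integral_Re) (intro set_integrable_mult_right in_Lp_1_integrable_cis[OF \<phi>], rule refl)
    also have "\<dots> = (LINT t:{0..2*pi}|lborel. 1 / pi * (\<phi> t * (\<psi> (real k) * cos (real k * (t - x) + \<beta> * pi / 2))))"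
      unfolding set_integral_mult_right[symmetric]
    proof (intro set_lebesgue_integral_cong allI impI)
      fix t
      \<comment> \<open>Evenness of the cosine flips the whole argument, so the phase becomes +
        \<beta> pi / 2 and the kernel depends on \<open>t - x\<close>.\<close>
      have "cos (- real k * t + (real k * x - \<beta> * pi / 2)) = cos (- (- real k * t + (real k * x - \<beta> * pi / 2)))"
        by (rule cos_minus[symmetric])
      also have "- (- real k * t + (real k * x - \<beta> * pi / 2)) = real k * (t - x) + \<beta> * pi / 2"
        by (simp add: algebra_simps)
      finally have "cos (- real k * t + (real k * x - \<beta> * pi / 2)) = cos (real k * (t - x) + \<beta> * pi / 2)" .
      then show "2 * Re (complex_of_real (\<psi> (real k) / (2 * pi)) *
          (complex_of_real (\<phi> t) * cis (- real k * t + (real k * x - \<beta> * pi / 2))))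
        = 1 / pi * (\<phi> t * (\<psi> (real k) * cos (real k * (t - x) + \<beta> * pi / 2)))"
        unfolding Re_complex_of_real cis.sel by (simp add: field_simps del: cos_minus)
    qed simp
    finally show ?thesis .
  qed
  have i: "set_integrable lborel {0..2*pi} (\<lambda>t. 1 / pi * (\<phi> t * (\<psi> (real k) * cos (real k * (t - x) + \<beta> * pi / 2))))" for k
  proof (intro set_integrable_mult_right set_integrable_mult_bounded[where B="\<bar>\<psi> (real k)\<bar>"] in_Lp_1_integrable[OF \<phi>])
    show "(\<lambda>t. \<psi> (real k) * cos (real k * (t - x) + \<beta> * pi / 2)) \<in> borel_measurable borel" by measurable
  qed (simp add: abs_mult mult_left_le)
  have "(\<Sum>k=n..m. 2 * Re (fcoef f (int k) * cis (real k * x)))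
    = (\<Sum>k=n..m. LINT t:{0..2*pi}|lborel. 1 / pi * (\<phi> t * (\<psi> (real k) * cos (real k * (t - x) + \<beta> * pi / 2))))"
    using n by (intro sum.cong one) auto
  also have "\<dots> = (LINT t:{0..2*pi}|lborel. \<Sum>k=n..m. 1 / pi * (\<phi> t * (\<psi> (real k) * cos (real k * (t - x) + \<beta> * pi / 2))))"
    by (rule set_integral_sum(2)[symmetric]) (rule i)
  also have "\<dots> = (LINT t:{0..2*pi}|lborel. 1 / pi * (\<phi> t * (\<Sum>k=n..m. \<psi> (real k) * cos (real k * (t - x) + \<beta> * pi / 2))))"
    by (simp only: sum_distrib_left)
  finally show ?thesis by (simp only: set_integral_mult_right)
qed

text \<open>The kernel is at most \<open>\<psi> n * H\<close>, and at most \<open>\<psi> n\<close>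
  after multiplication by the sine, so the peaked-kernel estimate bounds its norm for the exponent
  \<open>q\<close>. Hoelder's inequality pairs it with \<open>\<phi>\<close>.\<close>

lemma segment_bound:
  assumes pq: "1 < p" "1 < q" "1 / p + 1 / q = 1"
    and d: "is_psi_beta_deriv \<psi> \<beta> f \<phi>" and f: "in_Lp 1 f"
    and \<phi>: "in_Lp p \<phi>" "(LINT t:{0..2*pi}|lborel. \<bar>\<phi> t\<bar> powr p) \<le> 1"
    and pos: "\<And>k. 1 \<le> k \<Longrightarrow> 0 < \<psi> (real k)"
    and dec: "\<And>i j. 1 \<le> i \<Longrightarrow> i \<le> j \<Longrightarrow> \<psi> (real j) \<le> \<psi> (real i)"
    and n: "1 \<le> n" and H: "0 < H" "(\<Sum>k=n..m. \<psi> (real k)) \<le> \<psi> (real n) * H"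
    and x: "x \<in> {0..2*pi}"
  shows "\<bar>\<Sum>k=n..m. 2 * Re (fcoef f (int k) * cis (real k * x))\<bar>
    \<le> (2 * (1 + pi) powr q / (q - 1)) powr (1 / q) * (\<psi> (real n) * H powr (1 / p))"
proof -
  define C where "C = 2 * (1 + pi) powr q / (q - 1)"
  define L where "L = C powr (1 / q) * (\<psi> (real n) * H powr (1 / p))"
  define g where "g t = (\<Sum>k=n..m. \<psi> (real k) * cos (real k * t + \<beta> * pi / 2))" for t
  have "1 + pi \<noteq> 0" using pi_gt_zero by linarith
  then have C: "0 < C" using pq by (simp add: C_def)
  have L: "0 < L" using C H pos[OF n] by (simp add: L_def)
  have gc: "continuous_on UNIV g" unfolding g_def by (intro continuous_intros)
  have g1: "\<bar>g t\<bar> \<le> \<psi> (real n) * H" for t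
  proof -
    have "\<bar>g t\<bar> \<le> (\<Sum>k=n..m. \<bar>\<psi> (real k) * cos (real k * t + \<beta> * pi / 2)\<bar>)" unfolding g_def by (rule sum_abs)
    also have "\<dots> \<le> (\<Sum>k=n..m. \<psi> (real k))"
    proof (rule sum_mono)
      fix k assume "k \<in> {n..m}"
      then have "0 < \<psi> (real k)" using pos[of k] n by simp
      then show "\<bar>\<psi> (real k) * cos (real k * t + \<beta> * pi / 2)\<bar> \<le> \<psi> (real k)"
        by (simp add: abs_mult mult_left_le)
    qed
    finally show ?thesis using H by simp
  qed
  have g2: "\<bar>g t\<bar> * \<bar>sin (t / 2)\<bar> \<le> \<psi> (real n)" for t
    unfolding g_def using dec pos n by (intro cos_sum_decreasing) (auto intro: less_imp_le)
  have gper: "periodic2pi (\<lambda>t. \<bar>g t\<bar> powr q)"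
    unfolding periodic2pi_def g_def cos_nat_periodic by simp
  have gi: "set_integrable lborel {0..2*pi} (\<lambda>t. \<bar>g (t - x)\<bar> powr q)" for x
    using pq by (intro borel_integrable_atLeastAtMost' continuous_on_powr' continuous_on_const
        continuous_on_rabs continuous_on_compose2[OF gc] continuous_intros) auto
  have "(LINT t:{0..2*pi}|lborel. \<bar>g (t - x)\<bar> powr q) = (LINT t:{0..2*pi}|lborel. \<bar>g t\<bar> powr q)"
    using gi[of 0] x by (intro periodic_integral_translate[OF gper]) auto
  also have "\<dots> \<le> C * (\<psi> (real n) powr q * H powr (q - 1))"
    unfolding C_def using pq(2) H(1) less_imp_le[OF pos[OF n]] gc g1 g2 by (intro peaked_powr_integral_le) auto
  also have "\<dots> = L powr q"
  proof -
    \<comment> \<open>Conjugacy makes the exponent q - 1 in the q-th power become 1/p in the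
      norm.\<close>
    have "(q - 1) = 1 / p * q" using pq by (simp add: field_simps)
    then have "L powr q = C * (\<psi> (real n) powr q * H powr (q - 1))"
      using C H pos[OF n] pq by (simp add: L_def powr_mult powr_powr)
    then show ?thesis by simp
  qed
  finally have gq: "(LINT t:{0..2*pi}|lborel. \<bar>g (t - x)\<bar> powr q) \<le> L powr q" .
  have "set_integrable lborel {0..2*pi} (\<lambda>t. \<phi> t * g (t - x))"
    using d g1 by (intro set_integrable_mult_bounded[where B="\<psi> (real n) * H"] in_Lp_1_integrable
        borel_measurable_continuous_onI continuous_on_compose2[OF gc] continuous_intros)
      (auto simp: is_psi_beta_deriv_def)
  then have "\<bar>LINT t:{0..2*pi}|lborel. \<phi> t * g (t - x)\<bar> \<le> L"
    using \<phi> gi[of x] gq L pq by (intro Holder_bound) (auto simp: in_Lp_def)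
  moreover have "(\<Sum>k=n..m. 2 * Re (fcoef f (int k) * cis (real k * x)))
    = 1 / pi * (LINT t:{0..2*pi}|lborel. \<phi> t * g (t - x))"
    unfolding g_def by (rule psi_beta_deriv_segment[OF d f pos n])
  ultimately have "\<bar>\<Sum>k=n..m. 2 * Re (fcoef f (int k) * cis (real k * x))\<bar> \<le> 1 / pi * L"
    by (simp add: abs_mult divide_right_mono)
  also have "\<dots> \<le> 1 * L" using L pi_ge_two by (intro mult_right_mono) auto
  finally show ?thesis by (simp add: L_def C_def)
qed

section \<open>Essential suprema and the approximation from above\<close>

lemma Linf_norm_leI:
  assumes "g \<in> borel_measurable borel" "AE t in lborel. t \<in> {0..2*pi} \<longrightarrow> cmod (g t) \<le> c"
  shows "Linf_norm g \<le> ereal c"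
  unfolding Linf_norm_def
proof (rule esssup_I)
  show "(\<lambda>x. ereal (cmod (g x))) \<in> borel_measurable (restrict_space lborel {0..2 * pi})"
    using assms(1) by (intro measurable_restrict_space1) simp
  show "AE x in restrict_space lborel {0..2 * pi}. ereal (cmod (g x)) \<le> ereal c"
    using assms(2) by (subst AE_restrict_space_iff) auto
qed

text \<open>If the value at 0 exceeded the essential supremum, continuity would give an interval of
  positive length on which the function exceeds it too.\<close>

lemma Linf_norm_geI:
  assumes c: "continuous_on UNIV g"
  shows "ereal (cmod (g 0)) \<le> Linf_norm g"
proof (rule ccontr)
  let ?M = "restrict_space lborel {0..2*pi}"
  assume "\<not> ereal (cmod (g 0)) \<le> Linf_norm g"
  then obtain r where r: "Linf_norm g < ereal r" "ereal r < ereal (cmod (g 0))"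
    using ereal_dense2 by (metis not_le)
  have "AE x in ?M. ereal (cmod (g x)) \<le> Linf_norm g"
    unfolding Linf_norm_def by (rule esssup_AE)
  then have ae: "AE x in lborel. x \<in> {0..2*pi} \<longrightarrow> cmod (g x) < r"
    using r(1) by (subst (asm) AE_restrict_space_iff) (auto elim!: eventually_mono dest: le_less_trans)
  have "((\<lambda>x. cmod (g x)) \<longlongrightarrow> cmod (g 0)) (at 0)"
    using c by (intro tendsto_norm) (simp add: continuous_on_eq_continuous_at isCont_def)
  then have "eventually (\<lambda>x. r < cmod (g x)) (at 0)"
    using r(2) by (intro order_tendstoD) auto
  then obtain \<delta> where \<delta>: "0 < \<delta>" "\<And>x. x \<noteq> 0 \<Longrightarrow> \<bar>x\<bar> < \<delta> \<Longrightarrow> r < cmod (g x)"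
    unfolding eventually_at by (auto simp: dist_real_def)
  \<comment> \<open>0 is the left end of the interval over which the supremum is taken, so only a
    right neighbourhood is used.\<close>
  define e where "e = min (\<delta> / 2) pi"
  have e: "0 < e" "e < \<delta>" "e \<le> 2 * pi" using \<delta>(1) pi_gt_zero unfolding e_def by linarith+
  have "AE x in lborel. x \<notin> {0<..<e}"
    using ae
  proof eventually_elim
    case (elim x)
    then show ?case using \<delta>(2)[of x] e by force
  qed
  then have "{0<..<e} \<in> null_sets lborel" by (subst AE_iff_null_sets) auto
  then show False using e by (auto simp: null_sets_def)
qed

text \<open>The factor 2 dominates (1 + 2 pi) / (2 pi). The bound gives both the majorant for
  convergence of the series and the size of the one extra term removed when
  \<open>m = 2 * n\<close>.\<close>

lemma cmod_fcoef_class_le: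
  assumes p: "1 < p" and d: "is_psi_beta_deriv \<psi> \<beta> f \<phi>"
    and \<phi>: "in_Lp p \<phi>" "(LINT t:{0..2*pi}|lborel. \<bar>\<phi> t\<bar> powr p) \<le> 1"
    and k: "1 \<le> k" "0 < \<psi> (real k)"
  shows "cmod (fcoef f (int k)) \<le> 2 * \<psi> (real k)"
proof -
  have \<phi>1: "in_Lp 1 \<phi>" using d by (simp add: is_psi_beta_deriv_def)
  have "fcoef \<phi> (int k) = fcoef f (int k) / complex_of_real (\<psi> (real k)) * cis (\<beta> * pi / 2)"
    using d k by (simp add: is_psi_beta_deriv_def)
  then have "cmod (fcoef f (int k)) = \<psi> (real k) * cmod (fcoef \<phi> (int k))"
    using k by (simp add: norm_mult norm_divide)
  also have "cmod (fcoef \<phi> (int k)) \<le> 1 / (2 * pi) * (1 + 2 * pi)"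
    by (rule order_trans[OF cmod_fcoef_le[OF \<phi>1]])
      (intro mult_left_mono Lp_ball_integral_abs_le[OF p \<phi>(1) \<phi>1 \<phi>(2)], simp)
  also have "\<dots> \<le> 2" using pi_ge_two by (simp add: field_simps)
  finally show ?thesis using k by (simp add: mult.commute)
qed

lemma e_orth_class_upper:
  assumes p: "1 < p" and psi: "class_M_pp_inf \<psi>"
  shows "\<exists>C>0. \<forall>n\<ge>1. \<forall>f\<in>L_class \<psi> \<beta> p. \<forall>m\<in>{2 * n - 1, 2 * n}.
    e_orth_inf m f \<le> ereal (C * (\<psi> (real n) * (eta \<psi> (real n) - real n) powr (1 / p)))"
proof -
  from psi have M: "class_M \<psi>" by (auto simp: class_M_pp_inf_def class_M_plus_inf_def)
  from psi obtain K where K: "0 < K" "\<And>t. 1 \<le> t \<Longrightarrow> K \<le> eta \<psi> t - t"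
    by (auto simp: class_M_pp_inf_def)
  obtain C1 where C1: "0 < C1"
    "\<And>n m. 1 \<le> n \<Longrightarrow> (\<Sum>k=n..m. \<psi> (real k)) \<le> C1 * (\<psi> (real n) * (eta \<psi> (real n) - real n))"
    using tail_sum_le[OF psi] by blast
  define q where "q = p / (p - 1)"
  have q: "1 < q" "1 / p + 1 / q = 1" using p by (auto simp: q_def field_simps)
  define A where "A = (2 * (1 + pi) powr q / (q - 1)) powr (1 / q)"
  \<comment> \<open>The first summand is for the remainder after frequencies below \<open>n\<close>,
    the second for the single term at frequency \<open>n\<close>.\<close>
  define C where "C = A * C1 powr (1 / p) + 2 * (1 / K) powr (1 / p)"
  have pos: "0 < \<psi> (real k)" if "1 \<le> k" for k using class_M_pos[OF M, of "real k"] that by simp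
  have dec: "\<psi> (real j) \<le> \<psi> (real i)" if "1 \<le> i" "i \<le> j" for i j
    using class_M_decreasing[OF M, of "real i" "real j"] that by simp
  have A: "0 \<le> A" by (simp add: A_def)
  have C: "0 < C" using A K C1 unfolding C_def by (intro add_nonneg_pos) auto
  \<comment> \<open>The tail bound from index 1, uniform in the upper limit, already bounds all
    partial sums.\<close>
  have summ: "summable (\<lambda>k. \<psi> (real k))"
  proof -
    have "summable (\<lambda>k. \<psi> (real (Suc k)))"
    proof (rule bounded_imp_summable)
      show "0 \<le> \<psi> (real (Suc k))" for k using pos[of "Suc k"] by simp
      show "(\<Sum>k\<le>m. \<psi> (real (Suc k))) \<le> C1 * (\<psi> (real 1) * (eta \<psi> (real 1) - real 1))" for m
        using C1(2)[of 1 "Suc m"]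
        by (simp only: One_nat_def sum.atLeast1_atMost_eq lessThan_Suc_atMost)
    qed
    then show ?thesis using summable_Suc_iff[of "\<lambda>k. \<psi> (real k)"] by blast
  qed
  have main: "e_orth_inf m f \<le> ereal (C * (\<psi> (real n) * (eta \<psi> (real n) - real n) powr (1 / p)))"
    if n: "1 \<le> n" and fL: "f \<in> L_class \<psi> \<beta> p" and m: "m \<in> {2 * n - 1, 2 * n}" for n f m
  proof -
    define h where "h = eta \<psi> (real n) - real n"
    define W where "W = \<psi> (real n) * h powr (1 / p)"
    have h: "K \<le> h" "0 < h" using K(2)[of "real n"] K(1) n by (auto simp: h_def)
    obtain \<phi> where f: "in_Lp 1 f" and d: "is_psi_beta_deriv \<psi> \<beta> f \<phi>" and \<phi>: "in_Lp p \<phi>" "Lp_norm p \<phi> \<le> 1"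
      using fL by (auto simp: L_class_def)
    have \<phi>p: "(LINT t:{0..2*pi}|lborel. \<bar>\<phi> t\<bar> powr p) \<le> 1"
    proof (rule ccontr)
      assume "\<not> ?thesis"
      then have "1 < (LINT t:{0..2*pi}|lborel. \<bar>\<phi> t\<bar> powr p) powr (1 / p)"
        using p by (intro gr_one_powr) auto
      then show False using \<phi>(2) by (simp add: Lp_norm_def)
    qed
    define S where "S m t = Re (fcoef f 0) + (\<Sum>k=1..m. 2 * Re (fcoef f (int k) * cis (real k * t)))" for m t
    have fk: "cmod (fcoef f (int k)) \<le> 2 * \<psi> (real k)" if "1 \<le> k" for k
      by (rule cmod_fcoef_class_le[OF p d \<phi>(1) \<phi>p that pos[OF that]])
    have conv: "AE t in lborel. t \<in> {0..2*pi} \<longrightarrow> (\<lambda>m. S m t) \<longlonglongrightarrow> f t"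
      unfolding S_def by (rule fourier_series_converges_AE[OF f summable_mult[OF summ] fk])
    \<comment> \<open>The bound on finite segments does not depend on their upper end, so it passes
      to the limit.\<close>
    have ptw: "\<bar>f t - S (n - 1) t\<bar> \<le> A * C1 powr (1 / p) * W"
      if t: "t \<in> {0..2*pi}" and lim: "(\<lambda>m. S m t) \<longlonglongrightarrow> f t" for t
    proof (rule tendsto_upperbound)
      show "(\<lambda>m. \<bar>S m t - S (n - 1) t\<bar>) \<longlonglongrightarrow> \<bar>f t - S (n - 1) t\<bar>" by (intro tendsto_intros lim)
      show "eventually (\<lambda>m. \<bar>S m t - S (n - 1) t\<bar> \<le> A * C1 powr (1 / p) * W) sequentially"
      proof (rule eventually_sequentiallyI[of n])
        fix m assume mn: "n \<le> m"
        have "{1..m} = {1..n - 1} \<union> {n..m}" using n mn by auto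
        then have "S m t - S (n - 1) t = (\<Sum>k=n..m. 2 * Re (fcoef f (int k) * cis (real k * t)))"
          using n unfolding S_def by (subst (1) \<open>{1..m} = _\<close>, subst sum.union_disjoint) auto
        also have "\<bar>\<dots>\<bar> \<le> A * (\<psi> (real n) * (C1 * h) powr (1 / p))"
          unfolding A_def using C1(2)[OF n, of m] C1(1) h(2) pos dec
          by (intro segment_bound[OF p q d f \<phi>(1) \<phi>p _ _ n _ _ t]) (auto simp: h_def mult_ac)
        also have "(C1 * h) powr (1 / p) = C1 powr (1 / p) * h powr (1 / p)"
          using C1 h by (simp add: powr_mult)
        finally show "\<bar>S m t - S (n - 1) t\<bar> \<le> A * C1 powr (1 / p) * W" by (simp add: W_def mult_ac)
      qed
    qed simp
    have fn: "cmod (fcoef f (int n)) \<le> 2 * (1 / K) powr (1 / p) * W"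
    proof -
      \<comment> \<open>A single coefficient is of order \<open>\<psi> n\<close> without the power
        of \<open>h\<close>; the lower bound \<open>K\<close> on \<open>h\<close> supplies that
        power.\<close>
      have "1 \<le> (h / K) powr (1 / p)" using h K p by (intro ge_one_powr_ge_zero) auto
      also have "\<dots> = (1 / K) powr (1 / p) * h powr (1 / p)" using h K by (simp flip: powr_mult)
      finally have "\<psi> (real n) * 1 \<le> \<psi> (real n) * ((1 / K) powr (1 / p) * h powr (1 / p))"
        using pos[OF n] by (intro mult_left_mono) auto
      then show ?thesis using fk[OF n] by (simp add: W_def mult_ac)
    qed
    have CW: "A * C1 powr (1 / p) * W \<le> C * W" "A * C1 powr (1 / p) * W + 2 * (1 / K) powr (1 / p) * W = C * W"
      using pos[OF n] unfolding C_def W_def by (auto simp: algebra_simps)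
    define \<gamma> where "\<gamma> = {- int (n - 1)..int (n - 1)}"
    \<comment> \<open>\<open>\<gamma>\<close> has exactly 2n - 1 elements. For even \<open>m\<close>
      only \<open>n\<close>, not \<open>- n\<close>, is added, so the remainder need not be real and
      the extra term is estimated separately.\<close>
    define \<gamma>' where "\<gamma>' = (if m = 2 * n then insert (int n) \<gamma> else \<gamma>)"
    have card: "finite \<gamma>'" "card \<gamma>' = m" using m n by (auto simp: \<gamma>'_def \<gamma>_def)
    have Sg: "complex_of_real (S (n - 1) t) = (\<Sum>k\<in>\<gamma>. fcoef f k * cis (of_int k * t))" for t
      unfolding S_def \<gamma>_def by (rule symmetric_partial_sum)
    have "e_orth_inf m f \<le> Linf_norm (\<lambda>x. complex_of_real (f x) - (\<Sum>k\<in>\<gamma>'. fcoef f k * cis (of_int k * x)))"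
      unfolding e_orth_inf_def using card by (intro INF_lower) auto
    also have "\<dots> \<le> ereal (C * W)"
    proof (rule Linf_norm_leI)
      have [measurable]: "f \<in> borel_measurable borel" using f by (simp add: in_Lp_def)
      show "(\<lambda>x. complex_of_real (f x) - (\<Sum>k\<in>\<gamma>'. fcoef f k * cis (of_int k * x))) \<in> borel_measurable borel"
        by measurable
      show "AE t in lborel. t \<in> {0..2 * pi} \<longrightarrow>
        cmod (complex_of_real (f t) - (\<Sum>k\<in>\<gamma>'. fcoef f k * cis (of_int k * t))) \<le> C * W"
        using conv
      proof eventually_elim
        case (elim t)
        show ?case
        proof
          assume t: "t \<in> {0..2*pi}"
          have b: "cmod (complex_of_real (f t) - (\<Sum>k\<in>\<gamma>. fcoef f k * cis (of_int k * t))) \<le> A * C1 powr (1 / p) * W"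
            using ptw[OF t] elim t unfolding Sg[symmetric] by (simp flip: of_real_diff)
          show "cmod (complex_of_real (f t) - (\<Sum>k\<in>\<gamma>'. fcoef f k * cis (of_int k * t))) \<le> C * W"
          proof (cases "m = 2 * n")
            case True
            have "int n \<notin> \<gamma>" "finite \<gamma>" using n by (auto simp: \<gamma>_def)
            then have "complex_of_real (f t) - (\<Sum>k\<in>\<gamma>'. fcoef f k * cis (of_int k * t))
              = (complex_of_real (f t) - (\<Sum>k\<in>\<gamma>. fcoef f k * cis (of_int k * t))) - fcoef f (int n) * cis (of_int (int n) * t)"
              using True by (simp add: \<gamma>'_def)
            then have "cmod (complex_of_real (f t) - (\<Sum>k\<in>\<gamma>'. fcoef f k * cis (of_int k * t)))
              \<le> cmod (complex_of_real (f t) - (\<Sum>k\<in>\<gamma>. fcoef f k * cis (of_int k * t))) + cmod (fcoef f (int n))"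
              using norm_triangle_ineq4[of "complex_of_real (f t) - (\<Sum>k\<in>\<gamma>. fcoef f k * cis (of_int k * t))" "fcoef f (int n) * cis (of_int (int n) * t)"]
              by (simp only: norm_mult norm_cis mult_1_right)
            then show ?thesis using b fn CW by linarith
          next
            case False
            then show ?thesis using b CW by (simp add: \<gamma>'_def)
          qed
        qed
      qed
    qed
    finally show ?thesis by (simp add: W_def h_def)
  qed
  show ?thesis using C main by blast
qed

section \<open>The lower bound\<close>

text \<open>Each cosine is split into two exponentials; orthogonality keeps only the one of
  frequency \<open>j\<close>, whose phase takes the sign of \<open>j\<close>.\<close>

lemma fcoef_cos_sum:
  fixes c :: "nat \<Rightarrow> real"
  shows "fcoef (\<lambda>t. \<Sum>k=1..N. c k * cos (real k * t + \<theta>)) j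
    = (if j \<noteq> 0 \<and> \<bar>j\<bar> \<le> int N then complex_of_real (c (nat \<bar>j\<bar>) / 2) * cis (of_int (sgn j) * \<theta>) else 0)"
proof -
  define F where "F t = (\<Sum>k=1..N. c k * cos (real k * t + \<theta>))" for t
  define a where "a k = complex_of_real (c k / 2) * cis \<theta>" for k
  define b where "b k = complex_of_real (c k / 2) * cis (- \<theta>)" for k
  have F: "in_Lp 1 F"
  proof (rule in_Lp_continuous)
    show "periodic2pi F" unfolding periodic2pi_def F_def cos_nat_periodic by simp
  qed (auto simp: F_def intro!: continuous_intros)
  have e: "complex_of_real (F t) * cis (- (of_int j * t))
    = (\<Sum>k=1..N. a k * cis (of_int (int k - j) * t) + b k * cis (of_int (- int k - j) * t))" for t
  proof -
    have "complex_of_real (c k * cos (real k * t + \<theta>)) * cis (- (of_int j * t))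
      = a k * cis (of_int (int k - j) * t) + b k * cis (of_int (- int k - j) * t)" for k
    proof -
      have "complex_of_real (cos x) = (cis x + cis (- x)) / 2" for x by (simp add: complex_eq_iff)
      then have "complex_of_real (c k * cos (real k * t + \<theta>)) * cis (- (of_int j * t))
        = complex_of_real (c k / 2) * (cis (real k * t + \<theta>) * cis (- (of_int j * t)))
        + complex_of_real (c k / 2) * (cis (- (real k * t + \<theta>)) * cis (- (of_int j * t)))"
        unfolding of_real_mult by (simp only: of_real_divide of_real_numeral) (simp add: field_simps)
      also have "cis (real k * t + \<theta>) * cis (- (of_int j * t)) = cis \<theta> * cis (of_int (int k - j) * t)"
        unfolding cis_mult by (simp add: algebra_simps)
      also have "cis (- (real k * t + \<theta>)) * cis (- (of_int j * t)) = cis (- \<theta>) * cis (of_int (- int k - j) * t)"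
        unfolding cis_mult by (simp add: algebra_simps)
      finally show ?thesis by (simp only: a_def b_def mult.assoc)
    qed
    then show ?thesis unfolding F_def of_real_sum sum_distrib_right by simp
  qed
  have i: "set_integrable lborel {0..2*pi} (\<lambda>t. d * cis (x * t))" for d x
    using integrable_cis[of d x 0] by simp
  have "(LINT t:{0..2*pi}|lborel. complex_of_real (F t) * cis (- (of_int j * t)))
    = (\<Sum>k=1..N. (LINT t:{0..2*pi}|lborel. a k * cis (of_int (int k - j) * t))
        + (LINT t:{0..2*pi}|lborel. b k * cis (of_int (- int k - j) * t)))"
    unfolding e by (subst set_integral_sum(2)) (intro set_integral_add i, intro sum.cong refl set_integral_add(2) i)
  also have "\<dots> = complex_of_real (2 * pi) *
    ((\<Sum>k=1..N. if k = nat j \<and> 0 < j then a k else 0) + (\<Sum>k=1..N. if k = nat (- j) \<and> j < 0 then b k else 0))"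
    unfolding set_integral_mult_right integral_cis_int distrib_left sum_distrib_left sum.distrib
    by (intro arg_cong2[of _ _ _ _ "(+)"] sum.cong) auto
  finally have "fcoef F j = (\<Sum>k=1..N. if k = nat j \<and> 0 < j then a k else 0) + (\<Sum>k=1..N. if k = nat (- j) \<and> j < 0 then b k else 0)"
    unfolding fcoef_eq[OF F] by simp
  also have "\<dots> = (if j \<noteq> 0 \<and> \<bar>j\<bar> \<le> int N then complex_of_real (c (nat \<bar>j\<bar>) / 2) * cis (of_int (sgn j) * \<theta>) else 0)"
    by (cases j "0 :: int" rule: linorder_cases) (auto simp: a_def b_def nat_le_iff)
  finally show ?thesis by (simp only: F_def[abs_def])
qed

text \<open>The derivative carries the factors 1 / \<open>\<psi> k\<close> and the whole phase, so
  \<open>f\<close> has the same form for every \<open>\<beta>\<close>. The \<open>+ 0\<close> makes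
  \<open>f\<close> an instance of \<open>fcoef_cos_sum\<close> with phase 0.\<close>

lemma cos_sum_in_L_class:
  assumes p: "1 < p" and pos: "\<And>k. 1 \<le> k \<Longrightarrow> 0 < \<psi> (real k)"
    and norm: "(LINT t:{0..2*pi}|lborel. \<bar>\<Sum>k=1..N. d / \<psi> (real k) * cos (real k * t + \<beta> * pi / 2)\<bar> powr p) \<le> 1"
  shows "(\<lambda>t. \<Sum>k=1..N. d * cos (real k * t + 0)) \<in> L_class \<psi> \<beta> p"
proof -
  define f where "f t = (\<Sum>k=1..N. d * cos (real k * t + 0))" for t
  define \<phi> where "\<phi> t = (\<Sum>k=1..N. d / \<psi> (real k) * cos (real k * t + \<beta> * pi / 2))" for t
  have per: "periodic2pi f" "periodic2pi \<phi>"
    unfolding periodic2pi_def f_def \<phi>_def cos_nat_periodic by simp_all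
  have cont: "continuous_on UNIV f" "continuous_on UNIV \<phi>"
    unfolding f_def \<phi>_def divide_inverse by (auto intro!: continuous_intros)
  have fk: "fcoef f j = (if j \<noteq> 0 \<and> \<bar>j\<bar> \<le> int N then complex_of_real (d / 2) * cis (of_int (sgn j) * 0) else 0)" for j
    unfolding f_def[abs_def] by (rule fcoef_cos_sum)
  have \<phi>k: "fcoef \<phi> j = (if j \<noteq> 0 \<and> \<bar>j\<bar> \<le> int N
      then complex_of_real (d / \<psi> (real (nat \<bar>j\<bar>)) / 2) * cis (of_int (sgn j) * (\<beta> * pi / 2)) else 0)" for j
    unfolding \<phi>_def[abs_def] by (rule fcoef_cos_sum)
  have "is_psi_beta_deriv \<psi> \<beta> f \<phi>"
    unfolding is_psi_beta_deriv_def fk \<phi>k using in_Lp_continuous[OF per(2) cont(2), of 1]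
    by (auto simp: mult.commute)
  moreover have "Lp_norm p \<phi> \<le> 1"
  proof -
    have "0 \<le> (LINT t:{0..2*pi}|lborel. \<bar>\<phi> t\<bar> powr p)"
      unfolding set_lebesgue_integral_def by (intro integral_nonneg_AE) auto
    then show ?thesis unfolding Lp_norm_def using norm p by (intro powr_le1) (auto simp: \<phi>_def)
  qed
  moreover have "(LINT t:{-pi..pi}|lborel. \<phi> t) = 0"
  proof -
    have "complex_of_real (LINT t:{-pi..pi}|lborel. \<phi> t) = (LINT t:{-pi..pi}|lborel. complex_of_real (\<phi> t) * cis (- (of_int 0 * t)))"
      using set_integral_complex_of_real[of lborel "{-pi..pi}" \<phi>] by simp
    also have "\<dots> = 0" using \<phi>k[of 0] by (simp add: fcoef_def)
    finally show ?thesis by simp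
  qed
  moreover have "in_Lp 1 f" "in_Lp p \<phi>" using in_Lp_continuous per cont p by auto
  ultimately show ?thesis unfolding L_class_def f_def[symmetric] by auto
qed

text \<open>At the origin the sum equals \<open>d * N\<close>, and each of at most
  \<open>2 * n\<close> removed terms lowers the real part by at most d/2.\<close>

lemma remove_terms_cos_sum:
  fixes d :: real and n N :: nat
  assumes d: "0 \<le> d" and \<gamma>: "finite \<gamma>" "card \<gamma> \<le> 2 * n"
  defines "f \<equiv> \<lambda>t. \<Sum>k=1..N. d * cos (real k * t + 0)"
  shows "ereal (d * (real N - real n)) \<le> Linf_norm (\<lambda>x. complex_of_real (f x) - (\<Sum>k\<in>\<gamma>. fcoef f k * cis (of_int k * x)))"
proof -
  define g where "g x = complex_of_real (f x) - (\<Sum>k\<in>\<gamma>. fcoef f k * cis (of_int k * x))" for x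
  \<comment> \<open>Holds also for frequencies outside the spectrum, where the coefficient is 0, so
    the index set may be arbitrary.\<close>
  have fk: "Re (fcoef f j) \<le> d / 2" for j
    unfolding f_def fcoef_cos_sum using d by simp
  have "Re (\<Sum>k\<in>\<gamma>. fcoef f k) \<le> (\<Sum>k\<in>\<gamma>. d / 2)"
    unfolding Re_sum by (intro sum_mono fk)
  also have "\<dots> \<le> real (2 * n) * (d / 2)"
    using \<gamma>(2) d unfolding sum_constant by (intro mult_right_mono) auto
  finally have "d * (real N - real n) \<le> Re (g 0)"
    by (simp add: g_def f_def algebra_simps)
  also have "\<dots> \<le> cmod (g 0)" by (rule complex_Re_le_cmod)
  finally have "ereal (d * (real N - real n)) \<le> ereal (cmod (g 0))" by simp
  also have "\<dots> \<le> Linf_norm g"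
    unfolding g_def[abs_def] f_def by (intro Linf_norm_geI continuous_intros)
  finally show ?thesis by (simp add: g_def[abs_def])
qed

text \<open>One test function serves all \<open>m \<le> 2 * n\<close>, hence the odd and the even
  case together.\<close>

lemma e_orth_class_lower:
  assumes p: "1 < p" and psi: "class_M_pp_inf \<psi>"
    and d: "\<And>t. t \<ge> 1 \<Longrightarrow> (\<psi> has_real_derivative \<psi>' t) (at t within {1..})"
    and mono: "mono_on {1..} (\<lambda>t. \<psi> t / \<bar>\<psi>' t\<bar>)"
  shows "\<exists>c>0. \<forall>n\<ge>1. \<exists>f\<in>L_class \<psi> \<beta> p. \<forall>m\<le>2 * n.
    ereal (c * (\<psi> (real n) * (eta \<psi> (real n) - real n) powr (1 / p))) \<le> e_orth_inf m f"
proof -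
  from psi have M: "class_M \<psi>" by (auto simp: class_M_pp_inf_def class_M_plus_inf_def)
  from psi obtain K where K: "0 < K" "\<And>t. 1 \<le> t \<Longrightarrow> K \<le> eta \<psi> t - t"
    by (auto simp: class_M_pp_inf_def)
  obtain c0 where c0: "0 < c0"
    "\<And>n. 1 \<le> n \<Longrightarrow> c0 * \<psi> (real n) \<le> \<psi> (real (n + nat \<lceil>eta \<psi> (real n) - real n\<rceil>))"
    using psi_shift_ge[OF psi] by blast
  \<comment> \<open>Indices up to \<open>n\<close> contribute 1 + h / ln 2, those from n + 1 to
    \<open>N\<close> at most (h + 1) / c0; each 1 is replaced by h / K.\<close>
  define C2 where "C2 = 1 / K + 1 / ln 2 + (1 + 1 / K) / c0"
  define Cp where "Cp = 2 * (1 + pi) powr p / (p - 1)"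
  define A where "A = (Cp * ((1 / c0) powr p * (c0 * C2) powr (p - 1))) powr (1 / p)"
  have C2: "0 < C2" using K c0 by (auto simp: C2_def intro!: add_pos_pos divide_pos_pos)
  have "1 + pi \<noteq> 0" using pi_gt_zero by linarith
  then have Cp: "0 < Cp" using p by (simp add: Cp_def)
  have A: "0 < A" using Cp C2 c0 by (simp add: A_def)
  have pos: "0 < \<psi> (real k)" if "1 \<le> k" for k using class_M_pos[OF M, of "real k"] that by simp
  have dec: "\<psi> (real j) \<le> \<psi> (real i)" if "1 \<le> i" "i \<le> j" for i j
    using class_M_decreasing[OF M, of "real i" "real j"] that by simp
  have main: "\<exists>f\<in>L_class \<psi> \<beta> p. \<forall>m\<le>2 * n.
      ereal (1 / A * (\<psi> (real n) * (eta \<psi> (real n) - real n) powr (1 / p))) \<le> e_orth_inf m f" if n: "1 \<le> n" for n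
  proof -
    define h where "h = eta \<psi> (real n) - real n"
    have h: "K \<le> h" "0 < h" using K(2)[of "real n"] K(1) n by (auto simp: h_def)
    \<comment> \<open>At least \<open>h\<close> frequencies remain in the count after subtracting
      \<open>n\<close>, while the rounding exceeds \<open>h\<close> by at most 1 and so keeps
      \<open>\<psi> N\<close> comparable with \<open>\<psi> n\<close>.\<close>
    define N where "N = n + nat \<lceil>h\<rceil>"
    have N: "h \<le> real N - real n" "real N - real n \<le> h + 1" "n \<le> N" "1 \<le> N"
      using h n unfolding N_def by linarith+
    have \<psi>N: "c0 * \<psi> (real n) \<le> \<psi> (real N)" using c0(2)[OF n] by (simp add: N_def h_def)
    define b where "b k = \<psi> (real n) / \<psi> (real k)" for k :: nat
    have bpos: "0 < b k" if "1 \<le> k" for k using pos[OF that] pos[OF n] by (simp add: b_def)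
    have binc: "b i \<le> b j" if "1 \<le> i" "i \<le> j" for i j
      unfolding b_def using that pos[of i] pos[of j] pos[OF n] dec[of i j] by (intro divide_left_mono) auto
    have bN: "b N \<le> 1 / c0"
      using \<psi>N c0(1) pos[of N] N unfolding b_def by (simp add: field_simps)
    define \<phi>0 where "\<phi>0 t = (\<Sum>k=1..N. b k * cos (real k * t + \<beta> * pi / 2))" for t
    have sum_b: "(\<Sum>k=1..N. b k) \<le> C2 * h"
    proof -
      have "{1..N} = {1..n} \<union> {n+1..N}" using N n by auto
      then have "(\<Sum>k=1..N. b k) = (\<Sum>k=1..n. b k) + (\<Sum>k=n+1..N. b k)"
        by (simp add: sum.union_disjoint)
      also have "(\<Sum>k=1..n. b k) \<le> 1 + h / ln 2"
        unfolding b_def h_def by (rule psi_ratio_sum_le[OF M d mono n])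
      also have "(\<Sum>k=n+1..N. b k) \<le> (\<Sum>k=n+1..N. 1 / c0)"
        by (intro sum_mono order_trans[OF binc bN]) auto
      also have "\<dots> = (real N - real n) * (1 / c0)" using N by (simp add: of_nat_diff)
      also have "\<dots> \<le> (h + 1) * (1 / c0)" using N c0 by (intro mult_right_mono) auto
      also have "\<dots> \<le> (h + h / K) * (1 / c0)" using h K c0 by (intro mult_right_mono add_left_mono) auto
      also have "1 + h / ln 2 \<le> h / K + h / ln 2" using h K by (intro add_right_mono) auto
      finally show ?thesis by (simp add: C2_def algebra_simps add_divide_distrib)
    qed
    \<comment> \<open>The bound \<open>C2 * h\<close> is written as M * H with M = 1 / c0, the
      constant of the sine estimate below, to fit the peaked-kernel lemma.\<close>
    have \<phi>1: "\<bar>\<phi>0 t\<bar> \<le> 1 / c0 * (c0 * C2 * h)" for t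
    proof -
      have "\<bar>\<phi>0 t\<bar> \<le> (\<Sum>k=1..N. \<bar>b k * cos (real k * t + \<beta> * pi / 2)\<bar>)" unfolding \<phi>0_def by (rule sum_abs)
      also have "\<dots> \<le> (\<Sum>k=1..N. b k)"
      proof (rule sum_mono)
        fix k assume "k \<in> {1..N}"
        then have "0 < b k" using bpos[of k] by simp
        then show "\<bar>b k * cos (real k * t + \<beta> * pi / 2)\<bar> \<le> b k"
          by (simp add: abs_mult mult_left_le)
      qed
      finally show ?thesis using sum_b c0 by simp
    qed
    have \<phi>2: "\<bar>\<phi>0 t\<bar> * \<bar>sin (t / 2)\<bar> \<le> 1 / c0" for t
    proof -
      have "\<bar>\<phi>0 t\<bar> * \<bar>sin (t / 2)\<bar> \<le> b N"
        unfolding \<phi>0_def using N binc bpos[of 1] by (intro cos_sum_increasing) auto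
      then show ?thesis using bN by simp
    qed
    have \<phi>c: "continuous_on UNIV \<phi>0" unfolding \<phi>0_def by (intro continuous_intros)
    have "(LINT t:{0..2*pi}|lborel. \<bar>\<phi>0 t\<bar> powr p) \<le> Cp * ((1 / c0) powr p * (c0 * C2 * h) powr (p - 1))"
      unfolding Cp_def using c0 C2 h p \<phi>1 \<phi>2 \<phi>c by (intro peaked_powr_integral_le) auto
    also have "\<dots> = (A * h powr (1 - 1 / p)) powr p"
    proof -
      have "(1 - 1 / p) * p = p - 1" using p by (simp add: field_simps)
      then have hp: "(h powr (1 - 1 / p)) powr p = h powr (p - 1)" unfolding powr_powr by simp
      have Ap: "A powr p = Cp * ((1 / c0) powr p * (c0 * C2) powr (p - 1))"
        unfolding A_def powr_powr using Cp C2 c0(1) p by simp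
      have "(A * h powr (1 - 1 / p)) powr p = A powr p * h powr (p - 1)"
        by (simp only: powr_mult hp)
      moreover have "(c0 * C2 * h) powr (p - 1) = (c0 * C2) powr (p - 1) * h powr (p - 1)"
        by (simp only: powr_mult)
      ultimately show ?thesis by (simp only: Ap mult.assoc)
    qed
    finally have \<phi>n: "(LINT t:{0..2*pi}|lborel. \<bar>\<phi>0 t\<bar> powr p) \<le> (A * h powr (1 - 1 / p)) powr p" .
    \<comment> \<open>Normalises \<open>\<phi>0\<close> to norm at most 1. Then a * h = h^(1/p) / A,
      which is the required order.\<close>
    define a where "a = 1 / (A * h powr (1 - 1 / p))"
    have a: "0 < a" using A h by (simp add: a_def)
    define f where "f = (\<lambda>t. \<Sum>k=1..N. (a * \<psi> (real n)) * cos (real k * t + 0))"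
    have fL: "f \<in> L_class \<psi> \<beta> p"
      unfolding f_def
    proof (rule cos_sum_in_L_class[where \<psi>=\<psi>, OF p pos])
      have "(\<Sum>k=1..N. a * \<psi> (real n) / \<psi> (real k) * cos (real k * t + \<beta> * pi / 2)) = a * \<phi>0 t" for t
        by (simp add: \<phi>0_def b_def sum_distrib_left mult.assoc)
      then have "(LINT t:{0..2*pi}|lborel. \<bar>\<Sum>k=1..N. a * \<psi> (real n) / \<psi> (real k) * cos (real k * t + \<beta> * pi / 2)\<bar> powr p)
        = a powr p * (LINT t:{0..2*pi}|lborel. \<bar>\<phi>0 t\<bar> powr p)"
        using a by (simp add: abs_mult powr_mult)
      also have "\<dots> \<le> a powr p * (A * h powr (1 - 1 / p)) powr p" by (intro mult_left_mono \<phi>n) auto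
      also have "\<dots> = 1" using A h a by (simp add: a_def flip: powr_mult)
      finally show "(LINT t:{0..2*pi}|lborel. \<bar>\<Sum>k=1..N. a * \<psi> (real n) / \<psi> (real k) * cos (real k * t + \<beta> * pi / 2)\<bar> powr p) \<le> 1" .
    qed
    have val: "1 / A * (\<psi> (real n) * h powr (1 / p)) \<le> a * \<psi> (real n) * (real N - real n)"
    proof -
      have "h powr (1 / p) = h powr (1 - (1 - 1 / p))" by simp
      also have "\<dots> = h / h powr (1 - 1 / p)" using h unfolding powr_diff[of h 1] by simp
      finally have "1 / A * (\<psi> (real n) * h powr (1 / p)) = a * \<psi> (real n) * h"
        by (simp add: a_def)
      also have "\<dots> \<le> a * \<psi> (real n) * (real N - real n)"
        using N(1) a pos[OF n] by (intro mult_left_mono) auto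
      finally show ?thesis .
    qed
    have "ereal (1 / A * (\<psi> (real n) * h powr (1 / p))) \<le> e_orth_inf m f" if m: "m \<le> 2 * n" for m
      unfolding e_orth_inf_def
    proof (rule INF_greatest)
      fix \<gamma> :: "int set" assume "\<gamma> \<in> {\<gamma>. finite \<gamma> \<and> card \<gamma> = m}"
      then have \<gamma>: "finite \<gamma>" "card \<gamma> \<le> 2 * n" using m by auto
      have "ereal (1 / A * (\<psi> (real n) * h powr (1 / p))) \<le> ereal (a * \<psi> (real n) * (real N - real n))"
        using val by simp
      also have "\<dots> \<le> Linf_norm (\<lambda>x. complex_of_real (f x) - (\<Sum>k\<in>\<gamma>. fcoef f k * cis (of_int k * x)))"
        unfolding f_def using a pos[OF n] by (intro remove_terms_cos_sum \<gamma>) auto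
      finally show "ereal (1 / A * (\<psi> (real n) * h powr (1 / p)))
        \<le> Linf_norm (\<lambda>x. complex_of_real (f x) - (\<Sum>k\<in>\<gamma>. fcoef f k * cis (of_int k * x)))" .
    qed
    then show ?thesis using fL unfolding h_def by blast
  qed
  show ?thesis using A main by (intro exI[of _ "1 / A"]) auto
qed

text \<open>Both sequences lie between positive multiples of the same real sequence, so the
  quotients of the constants compare them; extended reals are only multiplied by positive
  reals.\<close>

lemma asymp_eqI_comparable:
  fixes r :: "nat \<Rightarrow> real"
  assumes "0 < c" "0 < C" "\<And>n. 1 \<le> n \<Longrightarrow> ereal (c * r n) \<le> a n" "\<And>n. 1 \<le> n \<Longrightarrow> a n \<le> ereal (C * r n)"
    and "0 < c'" "0 < C'" "\<And>n. 1 \<le> n \<Longrightarrow> ereal (c' * r n) \<le> b n" "\<And>n. 1 \<le> n \<Longrightarrow> b n \<le> ereal (C' * r n)"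
  shows "asymp_eq a b"
  unfolding asymp_eq_def
proof (intro exI conjI allI impI)
  show "0 < c' / C" "0 < C' / c" using assms by auto
  fix n :: nat assume n: "1 \<le> n"
  have "ereal (c' / C) * a n \<le> ereal (c' / C) * ereal (C * r n)"
    using assms(1,2,5) assms(4)[OF n] by (intro ereal_mult_left_mono) auto
  also have "\<dots> = ereal (c' * r n)" using assms(2) by simp
  also have "\<dots> \<le> b n" by (rule assms(7)[OF n])
  finally show "ereal (c' / C) * a n \<le> b n" .
  have "b n \<le> ereal (C' * r n)" by (rule assms(8)[OF n])
  also have "\<dots> = ereal (C' / c) * ereal (c * r n)" using assms(1) by simp
  also have "\<dots> \<le> ereal (C' / c) * a n"
    using assms(1,6) assms(3)[OF n] by (intro ereal_mult_left_mono) auto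
  finally show "b n \<le> ereal (C' / c) * a n" .
qed

theorem theorem1:
  fixes p \<beta> :: real and \<psi> \<psi>' :: "real \<Rightarrow> real"
  assumes "1 < p"
    and "class_M_pp_inf \<psi>"
    and "\<And>t. t \<ge> 1 \<Longrightarrow> (\<psi> has_real_derivative \<psi>' t) (at t within {1..})"
    and "mono_on {1..} (\<lambda>t. \<psi> t / \<bar>\<psi>' t\<bar>)"
    and "filterlim (\<lambda>t. \<psi> t / \<bar>\<psi>' t\<bar>) at_top at_top"
  shows "asymp_eq (\<lambda>n. e_orth_inf_class (2 * n - 1) (L_class \<psi> \<beta> p))
                  (\<lambda>n. e_orth_inf_class (2 * n) (L_class \<psi> \<beta> p))
       \<and> asymp_eq (\<lambda>n. e_orth_inf_class (2 * n) (L_class \<psi> \<beta> p))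
                  (\<lambda>n. ereal (\<psi> (real n) * (eta \<psi> (real n) - real n) powr (1 / p)))"
proof -
  define r where "r n = \<psi> (real n) * (eta \<psi> (real n) - real n) powr (1 / p)" for n
  obtain C where C: "0 < C" "\<And>n f m. 1 \<le> n \<Longrightarrow> f \<in> L_class \<psi> \<beta> p \<Longrightarrow> m \<in> {2 * n - 1, 2 * n}
      \<Longrightarrow> e_orth_inf m f \<le> ereal (C * r n)"
    using e_orth_class_upper[OF assms(1,2), of \<beta>] unfolding r_def by blast
  obtain c where c: "0 < c" "\<And>n. 1 \<le> n \<Longrightarrow> \<exists>f\<in>L_class \<psi> \<beta> p. \<forall>m\<le>2 * n. ereal (c * r n) \<le> e_orth_inf m f"
    using e_orth_class_lower[OF assms(1,2,3,4), of \<beta>] unfolding r_def by blast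
  have up: "e_orth_inf_class m (L_class \<psi> \<beta> p) \<le> ereal (C * r n)" if "1 \<le> n" "m \<in> {2 * n - 1, 2 * n}" for n m
    unfolding e_orth_inf_class_def using C(2) that by (intro SUP_least) auto
  have low: "ereal (c * r n) \<le> e_orth_inf_class m (L_class \<psi> \<beta> p)" if nm: "1 \<le> n" "m \<in> {2 * n - 1, 2 * n}" for n m
  proof -
    obtain f where "f \<in> L_class \<psi> \<beta> p" "ereal (c * r n) \<le> e_orth_inf m f"
      using c(2)[OF nm(1)] nm(2) by auto
    then show ?thesis unfolding e_orth_inf_class_def by (intro SUP_upper2[of f])
  qed
  show ?thesis
  proof
    show "asymp_eq (\<lambda>n. e_orth_inf_class (2 * n - 1) (L_class \<psi> \<beta> p))
        (\<lambda>n. e_orth_inf_class (2 * n) (L_class \<psi> \<beta> p))"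
      by (rule asymp_eqI_comparable[where r=r, OF c(1) C(1) low up c(1) C(1) low up]) auto
    show "asymp_eq (\<lambda>n. e_orth_inf_class (2 * n) (L_class \<psi> \<beta> p))
        (\<lambda>n. ereal (\<psi> (real n) * (eta \<psi> (real n) - real n) powr (1 / p)))"
      \<comment> \<open>Here the second sequence is \<open>r\<close> itself, compared with constants
        1.\<close>
      by (rule asymp_eqI_comparable[where r=r, OF c(1) C(1) low up zero_less_one zero_less_one])
        (auto simp: r_def)
  qed
qed

end
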